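(* Let $G$ be a $d$-regular graph of order $n$, with $d\ge 4$. Then there exists a spanning subgraph $H\subseteq G$ such that every connected component of $H$ is either a cycle or a cubic (3-regular) graph, and \[ f_o(L(G))\ge \frac{n}{2}-\frac{C_5(H)}{2}, \] where $C_5(H)$ is the number of components of $H$ isomorphic to $C_5$.
   Context: All graphs are finite and simple. An induced subgraph of a graph is called odd if every vertex of it has odd degree in it. $f_o(G)$ denotes the maximum order of an odd induced subgraph of $G$. $L(G)$ is the line graph of $G$. *)

theory Defs
  imports Complex_Main
begin

definition graph :: "'a set \<Rightarrow> 'a set set \<Rightarrow> bool" where
  "graph V E \<longleftrightarrow> finite V \<and> (\<forall>e\<in>E. e \<subseteq> V \<and> card e = 2)"

definition degree :: "'a set set \<Rightarrow> 'a \<Rightarrow> nat" where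
  "degree E v = card {e\<in>E. v \<in> e}"

definition regular :: "'a set \<Rightarrow> 'a set set \<Rightarrow> nat \<Rightarrow> bool" where
  "regular V E d \<longleftrightarrow> (\<forall>v\<in>V. degree E v = d)"

definition line_graph_edges :: "'a set set \<Rightarrow> 'a set set set" where
  "line_graph_edges E = {{e, f} | e f. e \<in> E \<and> f \<in> E \<and> e \<noteq> f \<and> e \<inter> f \<noteq> {}}"

definition induced_edges :: "'a set set \<Rightarrow> 'a set \<Rightarrow> 'a set set" where
  "induced_edges E S = {e\<in>E. e \<subseteq> S}"

definition odd_induced :: "'a set \<Rightarrow> 'a set set \<Rightarrow> 'a set \<Rightarrow> bool" where
  "odd_induced V E S \<longleftrightarrow> S \<subseteq> V \<and> (\<forall>v\<in>S. odd (degree (induced_edges E S) v))"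

definition f_o :: "'a set \<Rightarrow> 'a set set \<Rightarrow> nat" where
  "f_o V E = Max {card S | S. odd_induced V E S}"

definition reach :: "'a set set \<Rightarrow> 'a \<Rightarrow> 'a \<Rightarrow> bool" where
  "reach F = (\<lambda>u v. \<exists>e\<in>F. e = {u, v})\<^sup>*\<^sup>*"

definition components :: "'a set \<Rightarrow> 'a set set \<Rightarrow> 'a set set" where
  "components V F = {{u\<in>V. reach F v u} | v. v \<in> V}"

definition is_cycle :: "'a set \<Rightarrow> 'a set set \<Rightarrow> bool" where
  "is_cycle C F \<longleftrightarrow> C \<noteq> {} \<and> regular C F 2 \<and> (\<forall>u\<in>C. \<forall>v\<in>C. reach F u v)"

definition is_cubic :: "'a set \<Rightarrow> 'a set set \<Rightarrow> bool" where
  "is_cubic C F \<longleftrightarrow> regular C F 3"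

definition C5_count :: "'a set \<Rightarrow> 'a set set \<Rightarrow> nat" where
  "C5_count V F = card {C\<in>components V F. is_cycle C (induced_edges F C) \<and> card C = 5}"

end

theory Submission
  imports Defs
begin

text \<open>A bipartite set of edges each of whose components is complete bipartite with parts of different
  parity is an odd induced subgraph of the line graph. Packing such stars \<open>K\<^bsub>1,2t\<^esub>\<close> and copies of \<open>K\<^bsub>2,3\<^esub>\<close>
  as well as possible, local exchanges and a discharging argument show that fewer vertices stay
  uncovered than the packing can pay for, so that \<open>n/2\<close> edges are reached already without the
  correction by the number of pentagons.

  For the spanning subgraph, Tutte's theorem is used in the form that fractional weights satisfying the
  odd cut condition can be rounded to a perfect matching. Applied to an expansion of a bridgeless block
  of an odd \<open>d\<close>-regular graph it yields either a 2-factor of the block or a subgraph with all degrees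
  \<open>d - 2\<close> that uses, or avoids, a prescribed bridge at the block. Peeling off leaf blocks
  gives a spanning subgraph with 2-regular and \<open>(d - 2)\<close>-regular components, and one descends to
  \<open>d = 3\<close>. For even \<open>d\<close> there are no bridges and the same rounding gives Petersen's 2-factor.\<close>

section \<open>Matchings and Tutte's theorem\<close>

text \<open>An odd regular graph with bridges may have no 2-factor, and a bridge must be used or
  avoided by both of its sides alike. This is manageable because a block taken off has at most one
  edge to the part settled before it, so only that edge is prescribed.

  The degree \<open>d - 2\<close> is dictated by the weights. An odd cut pays r/d for each half-edge
  torn from its vertex and 1 - r/d for each edge whose two halves are torn apart. For odd d and r
  the half-edges torn off are odd in number, and 3(d - 2) \<ge> d excludes three of them; a single
  one leads to a bridge or to a boundary edge. For r = 2 the roles of the two costs are exchanged.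

  In the packing a piece with q edges and m vertices must pay for its own vertices first, which
  leaves 2q - m: this is 7 for K_{2,3}, k - 1 for a star with k leaves, and only 1 for the path
  K_{1,2}, which is therefore the critical piece. The assumption d \<ge> 4 enters through the
  shares: an uncovered vertex gives at most 1/3 to each covered neighbour, and at most 1/4 if it has
  no uncovered neighbour.\<close>

definition matching :: "'a set set \<Rightarrow> 'a set set \<Rightarrow> bool" where
  "matching E M \<longleftrightarrow> M \<subseteq> E \<and> (\<forall>e\<in>M. \<forall>f\<in>M. e \<noteq> f \<longrightarrow> e \<inter> f = {})"

text \<open>Restricting \<open>E\<close> to \<open>V\<close> inside the definition allows a barrier
  \<open>A\<close> to be removed by passing \<open>V - A\<close> with the original edge set.\<close>

definition odd_components :: "'a set \<Rightarrow> 'a set set \<Rightarrow> 'a set set" where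
  "odd_components V E = {C \<in> components V (induced_edges E V). odd (card C)}"

lemma graph_finite_edges: "graph V E \<Longrightarrow> finite E"
  unfolding graph_def by (meson PowI finite_Pow_iff finite_subset subsetI)

lemma graph_induced: "graph V E \<Longrightarrow> W \<subseteq> V \<Longrightarrow> graph W (induced_edges E W)"
  unfolding graph_def induced_edges_def by (auto intro: finite_subset)

lemma induced_induced: "W \<subseteq> U \<Longrightarrow> induced_edges (induced_edges E U) W = induced_edges E W"
  unfolding induced_edges_def by auto

lemma induced_self: "graph V E \<Longrightarrow> induced_edges E V = E"
  unfolding induced_edges_def graph_def by auto

lemma finite_arg_max:
  fixes f :: "'b \<Rightarrow> 'c::linorder"
  assumes "finite A" "A \<noteq> {}"
  obtains x where "x \<in> A" "\<And>y. y \<in> A \<Longrightarrow> f y \<le> f x"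
proof -
  have "Max (f ` A) \<in> f ` A" using assms by (intro Max_in) auto
  then obtain x where "x \<in> A" "f x = Max (f ` A)" by auto
  then show thesis using that assms(1) by (metis Max_ge finite_imageI image_eqI)
qed

lemma card_2_other:
  assumes "card e = 2" "x \<in> e" obtains y where "e = {x, y}" "y \<noteq> x"
  using assms by (auto simp: card_2_iff)

section \<open>Reachability and connected components\<close>

lemma reach_refl [simp]: "reach F u u"
  unfolding reach_def by simp

lemma reach_trans: "reach F u v \<Longrightarrow> reach F v w \<Longrightarrow> reach F u w"
  unfolding reach_def by simp

lemma reach_edge: "{u, v} \<in> F \<Longrightarrow> reach F u v"
  unfolding reach_def by (rule r_into_rtranclp) auto

lemma reach_sym: "reach F u v \<Longrightarrow> reach F v u"
  unfolding reach_def
proof (induction rule: rtranclp_induct)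
  case (step y z)
  then show ?case
    by (metis (mono_tags, lifting) converse_rtranclp_into_rtranclp insert_commute)
qed simp

lemma components_eq_class:
  assumes "C \<in> components V F" "x \<in> C"
  shows "C = {u\<in>V. reach F x u}"
proof -
  obtain v where v: "C = {u\<in>V. reach F v u}" "v \<in> V"
    using assms(1) unfolding components_def by blast
  then have "reach F v x" using assms(2) by blast
  then show ?thesis using v by (auto intro: reach_trans reach_sym)
qed

lemma components_subset: "C \<in> components V F \<Longrightarrow> C \<subseteq> V"
  unfolding components_def by auto

lemma components_disjoint:
  assumes "C \<in> components V F" "D \<in> components V F" "C \<noteq> D" shows "C \<inter> D = {}"
  using components_eq_class[OF assms(1)] components_eq_class[OF assms(2)] assms(3) by blast

lemma Union_components: "\<Union>(components V F) = V"
proof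
  show "V \<subseteq> \<Union>(components V F)"
  proof
    fix x assume "x \<in> V"
    then have "x \<in> {u\<in>V. reach F x u}" "{u\<in>V. reach F x u} \<in> components V F"
      unfolding components_def by auto
    then show "x \<in> \<Union>(components V F)" by blast
  qed
qed (use components_subset in blast)

lemma finite_components: "finite V \<Longrightarrow> finite (components V F)"
  unfolding components_def by simp

lemma components_edge:
  assumes "C \<in> components V F" "x \<in> C" "{x, y} \<in> F" "y \<in> V"
  shows "y \<in> C"
  using components_eq_class[OF assms(1,2)] assms by (auto intro: reach_edge)

section \<open>Maximum matchings, Gallai's lemma and the Tutte-Berge formula\<close>

lemma matching_unique: "matching E M \<Longrightarrow> e \<in> M \<Longrightarrow> f \<in> M \<Longrightarrow> x \<in> e \<Longrightarrow> x \<in> f \<Longrightarrow> e = f"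
  unfolding matching_def by blast

lemma matching_finite: "graph V E \<Longrightarrow> matching E M \<Longrightarrow> finite M"
  using graph_finite_edges unfolding matching_def by (metis finite_subset)

lemma matching_card_Union:
  assumes "graph V E" "matching E M"
  shows "card (\<Union>M) = 2 * card M"
proof -
  have "card (\<Union>M) = (\<Sum>e\<in>M. card e)"
  proof (rule card_Union_disjoint)
    show "pairwise disjnt M" using assms(2) unfolding matching_def pairwise_def disjnt_def by auto
    show "\<And>A. A \<in> M \<Longrightarrow> finite A"
      using assms unfolding graph_def matching_def by (meson finite_subset subsetD)
  qed
  also have "\<dots> = (\<Sum>e\<in>M. 2)"
    using assms unfolding graph_def matching_def by (intro sum.cong) auto
  finally show ?thesis by simp
qed

lemma matching_Union_subset: "graph V E \<Longrightarrow> matching E M \<Longrightarrow> \<Union>M \<subseteq> V"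
  unfolding graph_def matching_def by auto

definition max_matching :: "'a set set \<Rightarrow> 'a set set \<Rightarrow> bool" where
  "max_matching E M \<longleftrightarrow> matching E M \<and> (\<forall>N. matching E N \<longrightarrow> card N \<le> card M)"

lemma max_matching_exists:
  assumes "graph V E" shows "\<exists>M. max_matching E M"
proof -
  have fin: "finite {M. matching E M}"
    using graph_finite_edges[OF assms] unfolding matching_def by simp
  have "{M. matching E M} \<noteq> {}" unfolding matching_def by auto
  then obtain M where "M \<in> {M. matching E M}" "\<And>N. N \<in> {M. matching E M} \<Longrightarrow> card N \<le> card M"
    using fin finite_arg_max by metis
  then show ?thesis unfolding max_matching_def by auto
qed

lemma matching_insert:
  assumes "matching E M" "e \<in> E" "e \<inter> \<Union>M = {}" shows "matching E (insert e M)"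
  using assms unfolding matching_def by auto

lemma matching_add_edge:
  assumes "matching S M" "B \<in> S" "\<Union>M = N - B" "B \<subseteq> N"
  shows "matching S (insert B M)" "\<Union>(insert B M) = N"
proof -
  show "matching S (insert B M)" using matching_insert[OF assms(1,2)] assms(3) by blast
  show "\<Union>(insert B M) = N" using assms(3,4) by blast
qed

lemma matching_subset: "matching E M \<Longrightarrow> N \<subseteq> M \<Longrightarrow> matching E N"
  unfolding matching_def by blast

text \<open>Gallai's exchange argument: among the maximum matchings missing \<open>t\<close>, take the one sharing
  the most edges with a maximum matching missing \<open>u\<close> and \<open>v\<close>.\<close>

lemma gallai_transitive:
  assumes G: "graph V E" and "u \<noteq> v"
    and ut: "\<And>M. max_matching E M \<Longrightarrow> u \<in> \<Union>M \<or> t \<in> \<Union>M"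
    and tv: "\<And>M. max_matching E M \<Longrightarrow> t \<in> \<Union>M \<or> v \<in> \<Union>M"
    and t: "\<exists>N. max_matching E N \<and> t \<notin> \<Union>N"
    and M: "max_matching E M"
  shows "u \<in> \<Union>M \<or> v \<in> \<Union>M"
proof (rule ccontr)
  assume miss: "\<not> (u \<in> \<Union>M \<or> v \<in> \<Union>M)"
  define \<N> where "\<N> = {N. max_matching E N \<and> t \<notin> \<Union>N}"
  have "finite \<N>"
    by (rule finite_subset[of _ "Pow E"])
      (use graph_finite_edges[OF G] in \<open>simp_all add: \<N>_def max_matching_def matching_def Collect_mono Pow_def\<close>)
  moreover have "\<N> \<noteq> {}" using t unfolding \<N>_def by blast
  ultimately obtain N where N: "N \<in> \<N>" and Nmax: "\<And>N'. N' \<in> \<N> \<Longrightarrow> card (M \<inter> N') \<le> card (M \<inter> N)"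
    using finite_arg_max[of \<N> "\<lambda>N. card (M \<inter> N)"] by metis
  have mN: "max_matching E N" "matching E N" and tN: "t \<notin> \<Union>N"
    using N unfolding \<N>_def max_matching_def by auto
  have mM: "matching E M" using M unfolding max_matching_def by auto
  have finMN: "finite M" "finite N" using matching_finite G mM mN by blast+
  have finU: "finite (\<Union>M)" "finite (\<Union>N)"
    using G matching_Union_subset[OF G mM] matching_Union_subset[OF G mN(2)] unfolding graph_def
    by (auto intro: finite_subset)
  have tM: "t \<in> \<Union>M" using ut[OF M] miss by blast
  have uN: "u \<in> \<Union>N" "v \<in> \<Union>N" using ut[OF mN(1)] tv[OF mN(1)] tN by blast+
  have "card M = card N" using M mN(1) unfolding max_matching_def by (meson le_antisym)
  then have "card (\<Union>M) = card (\<Union>N)" using matching_card_Union[OF G] mM mN(2) by simp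
  then have "card (\<Union>M - \<Union>N) = card (\<Union>N - \<Union>M)"
    using finU by (metis card_Diff_subset_Int finite_Int inf_commute)
  moreover have "card {u, v} \<le> card (\<Union>N - \<Union>M)"
    using uN miss finU by (intro card_mono) auto
  ultimately have "2 \<le> card (\<Union>M - \<Union>N)" using \<open>u \<noteq> v\<close> by simp
  then have "\<not> \<Union>M - \<Union>N \<subseteq> {t}"
    by (metis card_mono card.empty card.insert empty_iff finite.emptyI finite.insertI not_less_eq_eq numeral_2_eq_2)
  then obtain x where x: "x \<in> \<Union>M" "x \<notin> \<Union>N" "x \<noteq> t" by blast
  then obtain e where e: "e \<in> M" "x \<in> e" by blast
  have "card e = 2" using e mM G unfolding matching_def graph_def by auto
  then obtain y where y: "e = {x, y}" "y \<noteq> x" using e(2) by (rule card_2_other)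
  have eE: "e \<in> E" using e mM unfolding matching_def by auto
  have yN: "y \<in> \<Union>N"
  proof (rule ccontr)
    assume "y \<notin> \<Union>N"
    then have "matching E (insert e N)" using x y eE mN(2) by (intro matching_insert) auto
    then have "card (insert e N) \<le> card N" using mN(1) unfolding max_matching_def by blast
    moreover have "e \<notin> N" using e x by blast
    ultimately show False using finMN(2) by simp
  qed
  then obtain f where f: "f \<in> N" "y \<in> f" by blast
  have fM: "f \<notin> M"
  proof
    assume "f \<in> M"
    moreover have "e \<noteq> f" using e f x by blast
    moreover have "y \<in> e \<inter> f" using y f by blast
    ultimately show False using mM e(1) unfolding matching_def by blast
  qed
  define N' where "N' = insert e (N - {f})"
  have "e \<inter> \<Union>(N - {f}) = {}"
  proof -
    have "y \<notin> g" if "g \<in> N - {f}" for g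
    proof
      assume "y \<in> g"
      moreover have "g \<inter> f = {}" using mN(2) f that unfolding matching_def by blast
      ultimately show False using f by blast
    qed
    then show ?thesis using x y by blast
  qed
  then have mN': "matching E N'"
    unfolding N'_def using matching_insert[OF matching_subset[OF mN(2), of "N - {f}"] eE] by blast
  have eN: "e \<notin> N" using e x by blast
  then have "e \<notin> N - {f}" by blast
  then have "card N' = Suc (card (N - {f}))"
    unfolding N'_def using finMN(2) by (metis card_insert_disjoint finite_Diff)
  also have "Suc (card (N - {f})) = card N" by (rule card_Suc_Diff1[OF finMN(2) f(1)])
  finally have "max_matching E N'" using mN(1) mN' unfolding max_matching_def by metis
  moreover have "t \<notin> \<Union>N'" unfolding N'_def using tN y x yN by auto
  ultimately have "card (M \<inter> N') \<le> card (M \<inter> N)" using Nmax unfolding \<N>_def by simp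
  moreover have "M \<inter> N' = insert e (M \<inter> N)" unfolding N'_def using e fM by auto
  ultimately show False using eN finMN by simp
qed

text \<open>By the exchange argument, the property that no maximum matching misses both ends is
  passed along walks. So \<open>M\<close> misses at most one vertex of each component, and a
  component with a missed vertex is odd because \<open>M\<close> matches its other vertices among
  themselves.\<close>

lemma tutte_berge_no_essential:
  assumes G: "graph V E"
    and iness: "\<And>v. v \<in> V \<Longrightarrow> \<exists>N. max_matching E N \<and> v \<notin> \<Union>N"
    and M: "max_matching E M"
  shows "card V \<le> 2 * card M + card (odd_components V E)"
proof -
  have finV: "finite V" using G unfolding graph_def by auto
  have mM: "matching E M" using M unfolding max_matching_def by auto
  have edge: "u \<in> \<Union>N \<or> v \<in> \<Union>N" if "{u, v} \<in> E" "max_matching E N" for u v N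
  proof (rule ccontr)
    assume *: "\<not> ?thesis"
    then have "matching E (insert {u, v} N)"
      using that unfolding max_matching_def by (intro matching_insert) auto
    moreover have "{u, v} \<notin> N" using * by auto
    moreover have "finite N" using that matching_finite[OF G] unfolding max_matching_def by blast
    moreover have "card (insert {u, v} N) \<le> card N"
      using calculation(1) that(2) unfolding max_matching_def by blast
    ultimately show False by simp
  qed
  have related: "u = v \<or> (\<forall>N. max_matching E N \<longrightarrow> u \<in> \<Union>N \<or> v \<in> \<Union>N)" if "reach E u v" for u v
    using that unfolding reach_def
  proof (induction rule: rtranclp_induct)
    case (step y z)
    then have yz: "{y, z} \<in> E" by auto
    then have "y \<in> V" using G unfolding graph_def by auto
    show ?case
    proof (cases "u = z \<or> u = y")
      case True
      then show ?thesis using edge[OF yz] by auto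
    next
      case False
      then have "\<And>N. max_matching E N \<Longrightarrow> u \<in> \<Union>N \<or> y \<in> \<Union>N" using step.IH by blast
      then show ?thesis using gallai_transitive[OF G, of u z y] edge[OF yz] iness[OF \<open>y \<in> V\<close>] False
        by blast
    qed
  qed simp
  define X where "X = V - \<Union>M"
  define cl where "cl x = {u\<in>V. reach E x u}" for x
  have "inj_on cl X"
  proof (rule inj_onI)
    fix x y assume xy: "x \<in> X" "y \<in> X" "cl x = cl y"
    have "y \<in> cl y" using xy unfolding cl_def X_def by simp
    then have "reach E x y" using xy(3) unfolding cl_def by blast
    then show "x = y" using related[of x y] M xy unfolding X_def by blast
  qed
  moreover have "cl ` X \<subseteq> odd_components V E"
  proof
    fix C assume "C \<in> cl ` X"
    then obtain x where x: "x \<in> X" "C = cl x" by blast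
    then have C: "C \<in> components V E" unfolding components_def cl_def X_def by auto
    have xC: "x \<in> C" using x unfolding cl_def X_def by auto
    define N where "N = {e\<in>M. e \<subseteq> C}"
    have cov: "\<Union>N = C - {x}"
    proof (intro equalityI subsetI)
      fix z assume "z \<in> \<Union>N"
      then show "z \<in> C - {x}" using x unfolding N_def X_def by auto
    next
      fix z assume z: "z \<in> C - {x}"
      then have "reach E x z" using x unfolding cl_def by auto
      then have "z \<in> \<Union>M" using related[of x z] z x M unfolding X_def by auto
      then obtain e where e: "e \<in> M" "z \<in> e" by blast
      have eE: "e \<in> E" using e mM unfolding matching_def by auto
      then have "card e = 2" "e \<subseteq> V" using G unfolding graph_def by auto
      then obtain y where y: "e = {z, y}" using e(2) by (metis card_2_other)
      then have "y \<in> C" using components_edge[OF C, of z y] z eE \<open>e \<subseteq> V\<close> by auto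
      then show "z \<in> \<Union>N" using e y z unfolding N_def by auto
    qed
    have "matching E N" using mM unfolding N_def by (rule matching_subset) auto
    then have "card (C - {x}) = 2 * card N" using matching_card_Union[OF G] cov by metis
    moreover have "finite C" using components_subset[OF C] finV finite_subset by blast
    ultimately have "card C = 2 * card N + 1" using xC
      by (metis Suc_eq_plus1 card_Suc_Diff1)
    then show "C \<in> odd_components V E" using C induced_self[OF G] unfolding odd_components_def by simp
  qed
  moreover have "finite (odd_components V E)"
    unfolding odd_components_def using finite_components[OF finV] by simp
  ultimately have "card X \<le> card (odd_components V E)" by (rule card_inj_on_le)
  moreover have "card X + 2 * card M = card V"
    using matching_card_Union[OF G mM] card_Diff_subset[of "\<Union>M" V] card_mono[of V "\<Union>M"]
      matching_Union_subset[OF G mM] finite_subset[of "\<Union>M" V] finV unfolding X_def by simp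
  ultimately show ?thesis by linarith
qed

text \<open>A vertex covered by every maximum matching is put into the barrier: its deletion lowers
  the matching number, which pays for the larger \<open>A\<close>. When no such vertex is left,
  Gallai's lemma applies with the empty barrier.\<close>

lemma tutte_berge:
  assumes "graph V E"
  shows "\<exists>A M. A \<subseteq> V \<and> matching E M \<and> card V + card A \<le> 2 * card M + card (odd_components (V - A) E)"
  using assms
proof (induction "card V" arbitrary: V E rule: less_induct)
  case less
  note G = less.prems
  have finV: "finite V" using G unfolding graph_def by auto
  obtain M where M: "max_matching E M" using max_matching_exists[OF G] by blast
  show ?case
  proof (cases "\<exists>v\<in>V. \<forall>N. max_matching E N \<longrightarrow> v \<in> \<Union>N")
    case True
    then obtain v where v: "v \<in> V" "\<And>N. max_matching E N \<Longrightarrow> v \<in> \<Union>N" by blast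
    define E' where "E' = induced_edges E (V - {v})"
    have G': "graph (V - {v}) E'" unfolding E'_def by (rule graph_induced[OF G]) auto
    have "card (V - {v}) < card V" using v finV by (meson card_Diff1_less)
    from less.hyps[OF this G'] obtain A N where AN: "A \<subseteq> V - {v}" "matching E' N"
      "card (V - {v}) + card A \<le> 2 * card N + card (odd_components (V - {v} - A) E')" by blast
    have mN: "matching E N" using AN(2) unfolding matching_def E'_def induced_edges_def by auto
    have vN: "v \<notin> \<Union>N" using AN(2) unfolding matching_def E'_def induced_edges_def by auto
    \<comment> \<open>Otherwise \<open>N\<close> would be a maximum matching of the whole graph that
      misses \<open>v\<close>.\<close>
    have "card N < card M"
    proof (rule ccontr)
      assume "\<not> card N < card M"
      then have "max_matching E N" using M mN unfolding max_matching_def by (meson le_trans not_le)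
      then show False using v vN by blast
    qed
    moreover have "odd_components (V - {v} - A) E' = odd_components (V - insert v A) E"
    proof -
      have "V - {v} - A = V - insert v A" by auto
      then show ?thesis unfolding odd_components_def E'_def
        by (subst induced_induced) auto
    qed
    moreover have "card V = card (V - {v}) + 1" using v finV
      by (metis Suc_eq_plus1 card_Suc_Diff1)
    moreover have "card (insert v A) = card A + 1"
      using AN(1) finV by (subst card_insert_disjoint) (auto intro: finite_subset)
    ultimately have "card V + card (insert v A) \<le> 2 * card M + card (odd_components (V - insert v A) E)"
      using AN(3) by simp
    then show ?thesis using AN(1) v M unfolding max_matching_def
      by (intro exI[of _ "insert v A"] exI[of _ M]) auto
  next
    case False
    then have "card V \<le> 2 * card M + card (odd_components V E)"
      using tutte_berge_no_essential[OF G _ M] by blast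
    then show ?thesis using M unfolding max_matching_def
      by (intro exI[of _ "{}"] exI[of _ M]) auto
  qed
qed

lemma even_card_odd_components:
  assumes "finite V"
  shows "even (card (odd_components V E)) \<longleftrightarrow> even (card V)"
proof -
  let ?\<C> = "components V (induced_edges E V)"
  have "card V = card (\<Union>?\<C>)" by (simp add: Union_components)
  also have "\<dots> = (\<Sum>C\<in>?\<C>. card C)"
  proof (rule card_Union_disjoint)
    show "pairwise disjnt ?\<C>" by (auto simp: pairwise_def disjnt_def dest: components_disjoint)
    show "finite A" if "A \<in> ?\<C>" for A using components_subset[OF that] assms by (rule finite_subset)
  qed
  finally show ?thesis unfolding odd_components_def
    using even_sum_iff[OF finite_components[OF assms], of card "induced_edges E V"] by simp
qed

text \<open>As \<open>card V\<close> is even, the number of odd components has the parity of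
  \<open>card A\<close>, so an excess of exactly one cannot occur. This slack is what makes a real
  bound below \<open>card A + 2\<close> sufficient in the rounding.\<close>

theorem tutte:
  assumes "graph V E" "even (card V)"
    and "\<And>A. A \<subseteq> V \<Longrightarrow> card (odd_components (V - A) E) < card A + 2"
  shows "\<exists>M. matching E M \<and> \<Union>M = V"
proof -
  have finV: "finite V" using assms unfolding graph_def by auto
  obtain A M where A: "A \<subseteq> V" and M: "matching E M"
    and le: "card V + card A \<le> 2 * card M + card (odd_components (V - A) E)"
    using tutte_berge[OF assms(1)] by blast
  have "card V = card (V - A) + card A"
    using A finV by (metis card_Diff_subset card_mono finite_subset le_add_diff_inverse2)
  then have "even (card (odd_components (V - A) E) + card A)"
    using even_card_odd_components[of "V - A" E] finV assms(2) by auto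
  then have "card (odd_components (V - A) E) \<noteq> card A + 1" by auto
  then have "card (odd_components (V - A) E) \<le> card A" using assms(3)[OF A] by linarith
  then have "card V \<le> card (\<Union>M)" using le matching_card_Union[OF assms(1) M] by linarith
  then have "\<Union>M = V" using matching_Union_subset[OF assms(1) M] finV by (meson card_seteq)
  then show ?thesis using M by blast
qed

section \<open>Rounding fractional matchings\<close>

definition support_graph :: "'a set \<Rightarrow> ('a \<Rightarrow> 'a \<Rightarrow> real) \<Rightarrow> 'a set set" where
  "support_graph V w = {{a, b} | a b. a \<in> V \<and> b \<in> V \<and> a \<noteq> b \<and> w a b > 0}"

definition cut_weight :: "'a set \<Rightarrow> ('a \<Rightarrow> 'a \<Rightarrow> real) \<Rightarrow> 'a set \<Rightarrow> real" where
  "cut_weight V w C = (\<Sum>a\<in>C. \<Sum>b\<in>V - C. w a b)"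

text \<open>Weight counting behind Tutte's condition: each odd component receives weight at least \<open>1\<close>,
  while a vertex of the barrier emits at most \<open>1\<close>.\<close>

lemma fractional_matching_barrier:
  fixes w :: "'a \<Rightarrow> 'a \<Rightarrow> real"
  assumes fin: "finite V"
    and nonneg: "\<And>a b. w a b \<ge> 0"
    and sym: "\<And>a b. w a b = w b a"
    and le1: "\<And>a. a \<in> V \<Longrightarrow> (\<Sum>b\<in>V. w a b) \<le> 1"
    and B: "B \<subseteq> A" "A \<subseteq> V"
    and odd_cut: "\<And>C. C \<subseteq> V - B \<Longrightarrow> odd (card C) \<Longrightarrow> cut_weight V w C \<ge> 1"
  shows "real (card (odd_components (V - A) (support_graph V w)))
    \<le> real (card A) - (\<Sum>a\<in>B. \<Sum>b\<in>B. w a b)"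
proof -
  let ?\<C> = "odd_components (V - A) (support_graph V w)"
  let ?F = "induced_edges (support_graph V w) (V - A)"
  have comp: "C \<in> components (V - A) ?F" if "C \<in> ?\<C>" for C
    using that unfolding odd_components_def by auto
  have finA: "finite A" using B(2) fin by (rule finite_subset)
  then have finB: "finite B" using B(1) by (rule rev_finite_subset)
  have fin\<C>: "finite ?\<C>" unfolding odd_components_def using fin finite_components[of "V - A" ?F] by simp
  have sub: "C \<subseteq> V - A" if "C \<in> ?\<C>" for C using components_subset[OF comp[OF that]] .
  have cutA: "cut_weight V w C = (\<Sum>a\<in>C. \<Sum>b\<in>A. w a b)" if C: "C \<in> ?\<C>" for C
    unfolding cut_weight_def
  proof (rule sum.cong[OF refl], rule sum.mono_neutral_right)
    fix a assume a: "a \<in> C"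
    show "finite (V - C)" using fin by simp
    show "A \<subseteq> V - C" using sub[OF C] B by blast
    show "\<forall>b\<in>V - C - A. w a b = 0"
    proof
      fix b assume b: "b \<in> V - C - A"
      show "w a b = 0"
      proof (rule ccontr)
        assume "w a b \<noteq> 0"
        then have "w a b > 0" using nonneg[of a b] by linarith
        moreover have "a \<in> V - A" using a sub[OF C] by blast
        ultimately have "{a, b} \<in> ?F"
          using a b unfolding induced_edges_def support_graph_def by blast
        then show False using components_edge[OF comp[OF C] a] b by blast
      qed
    qed
  qed
  have "real (card ?\<C>) = (\<Sum>C\<in>?\<C>. 1)" by simp
  also have "\<dots> \<le> (\<Sum>C\<in>?\<C>. \<Sum>a\<in>C. \<Sum>b\<in>A. w a b)"
  proof (rule sum_mono)
    fix C assume C: "C \<in> ?\<C>"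
    then have "cut_weight V w C \<ge> 1"
      using odd_cut[of C] sub[OF C] B unfolding odd_components_def by blast
    then show "1 \<le> (\<Sum>a\<in>C. \<Sum>b\<in>A. w a b)" using cutA[OF C] by simp
  qed
  also have "\<dots> = (\<Sum>a\<in>\<Union>?\<C>. \<Sum>b\<in>A. w a b)"
  proof (rule sum.Union_disjoint[symmetric, unfolded comp_def])
    show "\<forall>C\<in>?\<C>. finite C" using finite_subset[OF sub] fin by simp
    show "\<forall>C\<in>?\<C>. \<forall>D\<in>?\<C>. C \<noteq> D \<longrightarrow> C \<inter> D = {}"
      using components_disjoint comp by metis
  qed
  also have "\<dots> \<le> (\<Sum>a\<in>V - A. \<Sum>b\<in>A. w a b)"
  proof (rule sum_mono2)
    show "finite (V - A)" using fin by simp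
    show "\<Union>?\<C> \<subseteq> V - A" using sub by blast
  qed (simp add: sum_nonneg nonneg)
  also have "\<dots> = (\<Sum>b\<in>A. \<Sum>a\<in>V - A. w b a)"
    by (subst sum.swap) (simp add: sym)
  \<comment> \<open>A vertex of \<open>A\<close> sends out of \<open>A\<close> only what it does not
    spend inside. This saving is bounded below by the weight inside \<open>B\<close> in the
    end.\<close>
  also have "\<dots> \<le> (\<Sum>b\<in>A. 1 - (\<Sum>a\<in>A. w b a))"
  proof (rule sum_mono)
    fix b assume b: "b \<in> A"
    have "(\<Sum>a\<in>V. w b a) = (\<Sum>a\<in>V - A. w b a) + (\<Sum>a\<in>A. w b a)"
      using B(2) fin by (rule sum.subset_diff)
    then show "(\<Sum>a\<in>V - A. w b a) \<le> 1 - (\<Sum>a\<in>A. w b a)" using le1[of b] b B by auto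
  qed
  also have "\<dots> = real (card A) - (\<Sum>b\<in>A. \<Sum>a\<in>A. w b a)" by (simp add: sum_subtractf)
  finally have "real (card ?\<C>) \<le> real (card A) - (\<Sum>b\<in>A. \<Sum>a\<in>A. w b a)" .
  moreover have "(\<Sum>b\<in>A. \<Sum>a\<in>A. w b a) \<ge> (\<Sum>b\<in>B. \<Sum>a\<in>B. w b a)"
  proof -
    have "(\<Sum>b\<in>B. \<Sum>a\<in>B. w b a) \<le> (\<Sum>b\<in>B. \<Sum>a\<in>A. w b a)"
      using finA finB B nonneg by (intro sum_mono sum_mono2) auto
    also have "\<dots> \<le> (\<Sum>b\<in>A. \<Sum>a\<in>A. w b a)"
      using finA finB B nonneg by (intro sum_mono2) (auto intro: sum_nonneg)
    finally show ?thesis .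
  qed
  ultimately show ?thesis by linarith
qed

text \<open>The set \<open>B\<close> is deleted in advance and joined to every barrier
  \<open>A\<close>, so the odd components number at most |A| + |B| minus the weight inside
  \<open>B\<close>. The applications take either a pair with positive weight between its elements,
  which then extends the matching to one through a prescribed edge, or a set with at most one
  element.\<close>

theorem fractional_matching_rounding:
  fixes w :: "'a \<Rightarrow> 'a \<Rightarrow> real"
  assumes fin: "finite V"
    and nonneg: "\<And>a b. w a b \<ge> 0"
    and sym: "\<And>a b. w a b = w b a"
    and le1: "\<And>a. a \<in> V \<Longrightarrow> (\<Sum>b\<in>V. w a b) \<le> 1"
    and B: "B \<subseteq> V" "even (card (V - B))" "real (card B) - (\<Sum>a\<in>B. \<Sum>b\<in>B. w a b) < 2"
    and odd_cut: "\<And>C. C \<subseteq> V - B \<Longrightarrow> odd (card C) \<Longrightarrow> cut_weight V w C \<ge> 1"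
  shows "\<exists>M. matching (support_graph V w) M \<and> \<Union>M = V - B"
proof -
  let ?E = "induced_edges (support_graph V w) (V - B)"
  have "graph V (support_graph V w)"
    using fin unfolding graph_def support_graph_def by auto
  then have "graph (V - B) ?E" by (rule graph_induced) auto
  then have "\<exists>M. matching ?E M \<and> \<Union>M = V - B"
  proof (rule tutte)
    show "even (card (V - B))" by (rule B(2))
    fix A assume A: "A \<subseteq> V - B"
    have eq: "V - B - A = V - (A \<union> B)" by blast
    have "odd_components (V - B - A) ?E = odd_components (V - (A \<union> B)) (support_graph V w)"
      unfolding odd_components_def eq by (subst induced_induced) auto
    then have "real (card (odd_components (V - B - A) ?E)) \<le> real (card (A \<union> B)) - (\<Sum>a\<in>B. \<Sum>b\<in>B. w a b)"
      using fractional_matching_barrier[of V w B "A \<union> B", OF fin nonneg sym le1 _ _ odd_cut] A B(1) by auto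
    also have "card (A \<union> B) = card A + card B"
      using A B fin by (intro card_Un_disjoint) (auto intro: finite_subset)
    finally show "card (odd_components (V - B - A) ?E) < card A + 2" using B(3) by linarith
  qed
  then obtain M where M: "matching ?E M" "\<Union>M = V - B" by blast
  have "M \<subseteq> support_graph V w" using M(1) unfolding matching_def induced_edges_def by blast
  then have "matching (support_graph V w) M" using M(1) unfolding matching_def by simp
  then show ?thesis using M(2) by blast
qed

section \<open>Degree-constrained subgraphs of bridgeless blocks\<close>

text \<open>Cuts are bounded below by listing distinct crossing edges. The edges come unoriented;
  \<open>p\<close> turns each of them so that its first end lies in \<open>C\<close>.\<close>

lemma cut_weight_ge:
  fixes w :: "'a \<Rightarrow> 'a \<Rightarrow> real"
  assumes fin: "finite V" and "C \<subseteq> V"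
    and nonneg: "\<And>a b. w a b \<ge> 0" and sym: "\<And>a b. w a b = w b a"
    and I: "finite I" "inj_on (\<lambda>i. {a i, b i}) I"
    and sep: "\<And>i. i \<in> I \<Longrightarrow> a i \<in> V \<and> b i \<in> V \<and> (a i \<in> C) \<noteq> (b i \<in> C)"
    and ge: "\<And>i. i \<in> I \<Longrightarrow> w (a i) (b i) \<ge> \<kappa>"
  shows "real (card I) * \<kappa> \<le> cut_weight V w C"
proof -
  define p where "p i = (if a i \<in> C then (a i, b i) else (b i, a i))" for i
  have "{a i, b i} = {fst (p i), snd (p i)}" for i unfolding p_def by auto
  then have inj: "inj_on p I" using I(2) unfolding inj_on_def by metis
  have "real (card I) * \<kappa> = (\<Sum>i\<in>I. \<kappa>)" by simp
  also have "\<dots> \<le> (\<Sum>i\<in>I. case_prod w (p i))"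
    using ge sym by (intro sum_mono) (auto simp: p_def)
  also have "\<dots> = (\<Sum>x\<in>p ` I. case_prod w x)" using sum.reindex[OF inj, of "case_prod w"] by simp
  also have "\<dots> \<le> (\<Sum>x\<in>C \<times> (V - C). case_prod w x)"
  proof (rule sum_mono2)
    show "finite (C \<times> (V - C))" using fin finite_subset[OF \<open>C \<subseteq> V\<close>] by simp
    show "p ` I \<subseteq> C \<times> (V - C)" using sep by (auto simp: p_def)
  qed (auto simp: nonneg)
  also have "\<dots> = cut_weight V w C" unfolding cut_weight_def by (simp add: sum.cartesian_product)
  finally show ?thesis .
qed

lemma cut_weight_nonneg:
  assumes "\<And>a b. w a b \<ge> 0" shows "cut_weight V w C \<ge> 0"
  unfolding cut_weight_def by (intro sum_nonneg assms)

text \<open>\<open>Port v e\<close> is the half-edge of \<open>e\<close> at \<open>v\<close>; the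
  copies of a vertex are the units of its demand.\<close>

datatype 'a node = Copy 'a nat | Port 'a "'a set"

text \<open>In a perfect matching of the following weighted graph the edges \<open>e\<close> having a port matched to a
  copy form a subgraph in which every vertex of \<open>K\<close> has degree \<open>r\<close>; the clique on the ports of the
  boundary edges makes the use of those edges optional. The weights spread every \<open>r\<close>-factor condition
  uniformly over the \<open>d\<close> edges at a vertex.\<close>

locale gadget =
  fixes V :: "'a set" and E :: "'a set set" and d r :: nat and K :: "'a set"
  assumes G: "graph V E" and KV: "K \<subseteq> V" and deg: "\<And>v. v \<in> K \<Longrightarrow> degree E v = d"
    and r: "0 < r" "r < d"
begin

definition inc :: "'a \<Rightarrow> 'a set set" where "inc v = {e\<in>E. v \<in> e}"

definition inner :: "'a set set" where "inner = {e\<in>E. e \<subseteq> K}"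

definition bd :: "'a set set" where "bd = {e\<in>E. e \<inter> K \<noteq> {} \<and> \<not> e \<subseteq> K}"

definition cross :: "'a set \<Rightarrow> 'a set set" where
  "cross W = {e\<in>inner. e \<inter> W \<noteq> {} \<and> \<not> e \<subseteq> W}"

definition nodes :: "'a node set" where
  "nodes = {Copy v i | v i. v \<in> K \<and> i < r} \<union> {Port v e | v e. v \<in> K \<and> e \<in> inc v}"

text \<open>The weight left at a port after each of the \<open>r\<close> copies of its vertex has
  taken 1/d.\<close>

definition \<kappa> :: real where "\<kappa> = (real d - real r) / real d"

fun w1 :: "'a node \<Rightarrow> 'a node \<Rightarrow> real" where
  "w1 (Copy v i) (Port u e) = (if v = u then 1 / d else 0)"
| "w1 (Port u e) (Copy v i) = (if v = u then 1 / d else 0)"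
| "w1 _ _ = 0"

fun w2 :: "'a node \<Rightarrow> 'a node \<Rightarrow> real" where
  "w2 (Port u e) (Port v f) = (if e = f \<and> u \<noteq> v then \<kappa> else 0)"
| "w2 _ _ = 0"

text \<open>A boundary edge has one port only, which therefore spreads its \<kappa> over the ports
  of the other boundary edges. A single boundary edge finds no partner, and its port has total
  weight r/d < 1; hence row sums are bounded by 1 instead of being equal to 1.\<close>

fun w3 :: "'a node \<Rightarrow> 'a node \<Rightarrow> real" where
  "w3 (Port u e) (Port v f) = (if e \<noteq> f \<and> e \<in> bd \<and> f \<in> bd then \<kappa> / (real (card bd) - 1) else 0)"
| "w3 _ _ = 0"

definition w :: "'a node \<Rightarrow> 'a node \<Rightarrow> real" where "w a b = w1 a b + w2 a b + w3 a b"

section \<open>Counting and row sums in the gadget\<close>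

lemma finK: "finite K"
  using G KV unfolding graph_def by (simp add: finite_subset)

lemma finE: "finite E"
  using graph_finite_edges[OF G] .

lemma card_edge: "e \<in> E \<Longrightarrow> card e = 2"
  using G unfolding graph_def by auto

lemma fin_bd: "finite bd" and fin_inner: "finite inner" and fin_inc: "finite (inc v)"
  unfolding bd_def inner_def inc_def using finE by auto

lemma card_inc: "v \<in> K \<Longrightarrow> card (inc v) = d"
  using deg unfolding degree_def inc_def .

lemma kappa_pos: "\<kappa> > 0" and kappa_r: "real r / real d + \<kappa> = 1"
  using r unfolding \<kappa>_def by (auto simp: field_simps)

lemma inc_cases: "v \<in> K \<Longrightarrow> e \<in> inc v \<Longrightarrow> e \<in> inner \<or> e \<in> bd"
  unfolding inc_def inner_def bd_def by auto

lemma inner_bd_disjoint: "e \<in> inner \<Longrightarrow> e \<notin> bd"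
  unfolding inner_def bd_def by auto

lemma bd_end:
  assumes "e \<in> bd" obtains v where "e \<inter> K = {v}"
proof -
  have e: "e \<in> E" "e \<inter> K \<noteq> {}" "\<not> e \<subseteq> K" using assms unfolding bd_def by auto
  then obtain v where v: "v \<in> e" "v \<in> K" by blast
  then obtain u where "e = {v, u}" using card_edge[OF e(1)] card_2_other by metis
  then have "e \<inter> K = {v}" using e v by auto
  then show thesis using that by blast
qed

lemma bd_end_unique: "e \<in> bd \<Longrightarrow> u \<in> e \<Longrightarrow> u \<in> K \<Longrightarrow> v \<in> e \<Longrightarrow> v \<in> K \<Longrightarrow> u = v"
  using bd_end[of e] by (metis Int_iff singletonD)

lemma nodes_Copy [simp]: "Copy v i \<in> nodes \<longleftrightarrow> v \<in> K \<and> i < r"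
  and nodes_Port [simp]: "Port v e \<in> nodes \<longleftrightarrow> v \<in> K \<and> e \<in> inc v"
  unfolding nodes_def by auto

lemma nodes_eq: "nodes = case_prod Copy ` (K \<times> {..<r}) \<union> case_prod Port ` (SIGMA v:K. inc v)"
  unfolding nodes_def by auto

lemma fin_nodes: "finite nodes"
  unfolding nodes_eq using finK fin_inc by auto

lemma inj_Copy: "inj_on (case_prod Copy) A" and inj_Port: "inj_on (case_prod Port) B"
  by (auto simp: inj_on_def)

lemma sum_nodes:
  "(\<Sum>b\<in>nodes. f b) = (\<Sum>v\<in>K. \<Sum>i<r. f (Copy v i)) + (\<Sum>v\<in>K. \<Sum>e\<in>inc v. f (Port v e))"
proof -
  have "(\<Sum>b\<in>nodes. f b) = (\<Sum>b\<in>case_prod Copy ` (K \<times> {..<r}). f b)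
      + (\<Sum>b\<in>case_prod Port ` (SIGMA v:K. inc v). f b)"
    unfolding nodes_eq using finK fin_inc by (intro sum.union_disjoint) auto
  also have "(\<Sum>b\<in>case_prod Copy ` (K \<times> {..<r}). f b) = (\<Sum>v\<in>K. \<Sum>i<r. f (Copy v i))"
    by (subst sum.reindex[OF inj_Copy]) (simp add: sum.cartesian_product case_prod_beta comp_def)
  also have "(\<Sum>b\<in>case_prod Port ` (SIGMA v:K. inc v). f b) = (\<Sum>v\<in>K. \<Sum>e\<in>inc v. f (Port v e))"
    using finK fin_inc by (subst sum.reindex[OF inj_Port]) (simp add: sum.Sigma case_prod_beta comp_def)
  finally show ?thesis .
qed

lemma sum_inc:
  fixes g :: "'a set \<Rightarrow> 'b::semiring_1"
  shows "(\<Sum>v\<in>K. \<Sum>e\<in>inc v. g e) = (\<Sum>e\<in>E. of_nat (card (e \<inter> K)) * g e)"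
proof -
  have "(\<Sum>v\<in>K. \<Sum>e\<in>inc v. g e) = (\<Sum>e\<in>E. \<Sum>v\<in>{v\<in>K. v \<in> e}. g e)"
    unfolding inc_def using finK finE by (rule sum.swap_restrict)
  also have "\<dots> = (\<Sum>e\<in>E. of_nat (card (e \<inter> K)) * g e)"
    by (intro sum.cong refl) (auto simp: Int_def conj_commute)
  finally show ?thesis .
qed

lemma card_nodes: "card nodes = r * card K + d * card K"
proof -
  have "card nodes = (\<Sum>b\<in>nodes. 1)" by simp
  also have "\<dots> = r * card K + d * card K"
    unfolding sum_nodes using card_inc by simp
  finally show ?thesis .
qed

lemma w1_nonneg: "w1 a b \<ge> 0" by (cases "(a, b)" rule: w1.cases) auto
lemma w2_nonneg: "w2 a b \<ge> 0" using kappa_pos by (cases "(a, b)" rule: w2.cases) auto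
lemma w3_nonneg: "w3 a b \<ge> 0"
proof (cases "(a, b)" rule: w3.cases)
  case (1 u e v f)
  have "card bd \<ge> 1" if "e \<in> bd"
    using that fin_bd by (metis One_nat_def Suc_leI card_gt_0_iff empty_iff)
  then show ?thesis using 1 kappa_pos by auto
qed auto

lemma w1_sym: "w1 a b = w1 b a" by (cases "(a, b)" rule: w1.cases) auto
lemma w2_sym: "w2 a b = w2 b a" by (cases "(a, b)" rule: w2.cases) auto
lemma w3_sym: "w3 a b = w3 b a" by (cases "(a, b)" rule: w3.cases) auto

lemma w_nonneg: "w a b \<ge> 0" unfolding w_def using w1_nonneg[of a b] w2_nonneg[of a b] w3_nonneg[of a b] by linarith
lemma w_sym: "w a b = w b a" unfolding w_def using w1_sym[of a b] w2_sym[of a b] w3_sym[of a b] by simp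

text \<open>A copy meets \<open>d\<close> ports with weight 1/d each. A port gives r/d to the copies
  and at most \<kappa> to its twin or to the clique, and it never has both kinds of
  partners.\<close>

lemma row_sum_le_1:
  assumes "a \<in> nodes" shows "(\<Sum>b\<in>nodes. w a b) \<le> 1"
proof (cases a)
  case (Copy v i)
  have "(\<Sum>b\<in>nodes. w a b) = (\<Sum>u\<in>K. \<Sum>e\<in>inc u. if v = u then 1 / d else 0)"
    unfolding sum_nodes Copy w_def by simp
  also have "\<dots> = (\<Sum>u\<in>K. if v = u then 1 else 0)"
    using card_inc r by (intro sum.cong) auto
  also have "\<dots> \<le> 1" using finK by simp
  finally show ?thesis .
next
  case (Port u e)
  then have u: "u \<in> K" "e \<in> inc u" using assms by auto
  then have eE: "e \<in> E" and ue: "u \<in> e" unfolding inc_def by auto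
  have "(\<Sum>v\<in>K. \<Sum>i<r. w a (Copy v i)) = (\<Sum>v\<in>K. if v = u then real r / d else 0)"
    unfolding Port w_def by (intro sum.cong) auto
  also have "\<dots> = real r / d" using finK u by simp
  finally have copies: "(\<Sum>v\<in>K. \<Sum>i<r. w a (Copy v i)) = real r / d" .
  have "(\<Sum>v\<in>K. \<Sum>f\<in>inc v. w a (Port v f)) =
      (\<Sum>v\<in>K. \<Sum>f\<in>inc v. w2 a (Port v f)) + (\<Sum>v\<in>K. \<Sum>f\<in>inc v. w3 a (Port v f))"
    unfolding Port w_def by (simp add: sum.distrib)
  also have "(\<Sum>v\<in>K. \<Sum>f\<in>inc v. w2 a (Port v f)) = (\<Sum>v\<in>K. if v \<in> e \<and> v \<noteq> u then \<kappa> else 0)"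
  proof (intro sum.cong refl)
    fix v
    have "(\<Sum>f\<in>inc v. w2 a (Port v f)) = (\<Sum>f\<in>inc v. if f = e then (if u \<noteq> v then \<kappa> else 0) else 0)"
      unfolding Port by (intro sum.cong) auto
    also have "\<dots> = (if v \<in> e \<and> v \<noteq> u then \<kappa> else 0)"
      using fin_inc[of v] eE by (auto simp: sum.delta inc_def)
    finally show "(\<Sum>f\<in>inc v. w2 a (Port v f)) = (if v \<in> e \<and> v \<noteq> u then \<kappa> else 0)" .
  qed
  also have "\<dots> = real (card {v\<in>K. v \<in> e \<and> v \<noteq> u}) * \<kappa>"
    using finK by (simp add: sum.If_cases Int_def)
  also have "(\<Sum>v\<in>K. \<Sum>f\<in>inc v. w3 a (Port v f))
      = (\<Sum>f\<in>E. real (card (f \<inter> K)) * (if e \<noteq> f \<and> e \<in> bd \<and> f \<in> bd then \<kappa> / (real (card bd) - 1) else 0))"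
    unfolding Port using sum_inc[of "\<lambda>f. if e \<noteq> f \<and> e \<in> bd \<and> f \<in> bd then \<kappa> / (real (card bd) - 1) else 0"] by simp
  also have "\<dots> = (\<Sum>f\<in>E. if f \<in> (if e \<in> bd then bd - {e} else {}) then \<kappa> / (real (card bd) - 1) else 0)"
  proof (intro sum.cong refl)
    fix f
    have "card (f \<inter> K) = 1" if "f \<in> bd" using bd_end[OF that] by (metis is_singletonI is_singleton_altdef)
    then show "real (card (f \<inter> K)) * (if e \<noteq> f \<and> e \<in> bd \<and> f \<in> bd then \<kappa> / (real (card bd) - 1) else 0)
      = (if f \<in> (if e \<in> bd then bd - {e} else {}) then \<kappa> / (real (card bd) - 1) else 0)" by auto
  qed
  also have "\<dots> = real (card (if e \<in> bd then bd - {e} else {})) * (\<kappa> / (real (card bd) - 1))"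
  proof -
    have "E \<inter> (if e \<in> bd then bd - {e} else {}) = (if e \<in> bd then bd - {e} else {})"
      unfolding bd_def by auto
    then show ?thesis using finE by (simp only: sum.inter_restrict[symmetric] sum_constant)
  qed
  finally have ports: "(\<Sum>v\<in>K. \<Sum>f\<in>inc v. w a (Port v f)) = real (card {v\<in>K. v \<in> e \<and> v \<noteq> u}) * \<kappa>
    + real (card (if e \<in> bd then bd - {e} else {})) * (\<kappa> / (real (card bd) - 1))" .
  have "(\<Sum>v\<in>K. \<Sum>f\<in>inc v. w a (Port v f)) \<le> \<kappa>"
  proof (cases "e \<in> bd")
    case True
    then have "{v\<in>K. v \<in> e \<and> v \<noteq> u} = {}" using bd_end_unique[OF True ue u(1)] by blast
    moreover have "real (card (bd - {e})) = real (card bd) - 1"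
      using True fin_bd by (metis card_Suc_Diff1 diff_add_cancel of_nat_Suc add.commute add_diff_cancel_left')
    \<comment> \<open>For \<open>card bd = 1\<close> the quotient is a division by 0 with value 0,
      and the clique contributes nothing.\<close>
    ultimately show ?thesis unfolding ports \<open>{v\<in>K. v \<in> e \<and> v \<noteq> u} = {}\<close>
      using True kappa_pos by (cases "card bd = 1") auto
  next
    case False
    then have "e \<subseteq> K" using inc_cases[OF u] unfolding inner_def by auto
    obtain x where x: "e = {u, x}" "x \<noteq> u" using card_2_other[OF card_edge[OF eE] ue] .
    have "{v\<in>K. v \<in> e \<and> v \<noteq> u} = {x}" using x \<open>e \<subseteq> K\<close> by auto
    then show ?thesis unfolding ports using False by simp
  qed
  then show ?thesis unfolding sum_nodes copies using kappa_r by linarith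
qed

section \<open>Gadget cuts of weight less than 1\<close>

lemma cut_weight_split:
  "cut_weight nodes w C = cut_weight nodes w1 C + cut_weight nodes w2 C + cut_weight nodes w3 C"
  unfolding cut_weight_def w_def by (simp add: sum.distrib)

text \<open>If the copies \<open>i\<close> and \<open>j\<close> of \<open>v\<close> were on
  different sides, each of the \<open>d\<close> ports at \<open>v\<close> would be cut from one of
  them, at cost 1/d each.\<close>

lemma cut_nosplit:
  assumes C: "C \<subseteq> nodes" and lt: "cut_weight nodes w C < 1"
    and v: "v \<in> K" "i < r" "j < r" "Copy v i \<in> C"
  shows "Copy v j \<in> C"
proof (rule ccontr)
  assume j: "Copy v j \<notin> C"
  have "real (card (inc v)) * (1 / d) \<le> cut_weight nodes w1 C"
  proof (rule cut_weight_ge[where a = "\<lambda>e. Port v e" and b = "\<lambda>e. if Port v e \<in> C then Copy v j else Copy v i"])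
    show "inj_on (\<lambda>e. {Port v e, if Port v e \<in> C then Copy v j else Copy v i}) (inc v)"
      by (auto simp: inj_on_def doubleton_eq_iff split: if_splits)
  qed (use fin_nodes C w1_nonneg w1_sym fin_inc v j in auto)
  then have "1 \<le> cut_weight nodes w1 C" using card_inc v r by simp
  then show False
    using lt cut_weight_split[of C] cut_weight_nonneg[of w2 nodes C, OF w2_nonneg] cut_weight_nonneg[of w3 nodes C, OF w3_nonneg]
    by linarith
qed

text \<open>Copy 0 represents all copies of a vertex, since cuts of weight less than 1 do not split
  them.\<close>

definition side :: "'a node set \<Rightarrow> 'a set" where "side C = {v\<in>K. Copy v 0 \<in> C}"

definition mismatch :: "'a node set \<Rightarrow> ('a \<times> 'a set) set" where
  "mismatch C = {(v, e). v \<in> K \<and> e \<in> inc v \<and> (Port v e \<in> C) \<noteq> (v \<in> side C)}"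

definition severed :: "'a node set \<Rightarrow> 'a set set" where
  "severed C = {e\<in>inner. \<exists>u\<in>e. \<exists>v\<in>e. Port u e \<in> C \<and> Port v e \<notin> C}"

lemma side_Copy:
  assumes "C \<subseteq> nodes" "cut_weight nodes w C < 1" "v \<in> K" "i < r"
  shows "Copy v i \<in> C \<longleftrightarrow> v \<in> side C"
  using cut_nosplit[OF assms(1,2,3), of i 0] cut_nosplit[OF assms(1,2,3), of 0 i] assms r
  unfolding side_def by auto

lemma fin_mismatch: "finite (mismatch C)"
  by (rule finite_subset[of _ "SIGMA v:K. inc v"]) (use finK fin_inc in \<open>auto simp: mismatch_def\<close>)

text \<open>A mismatched port is separated from all \<open>r\<close> copies of its vertex, and each
  of these edges costs 1/d.\<close>

lemma cut_mismatch:
  assumes C: "C \<subseteq> nodes" and lt: "cut_weight nodes w C < 1"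
  shows "real (card (mismatch C)) * (real r / real d) \<le> cut_weight nodes w1 C"
proof -
  have "real (card (mismatch C \<times> {..<r})) * (1 / d) \<le> cut_weight nodes w1 C"
  proof (rule cut_weight_ge[where a = "\<lambda>x. Port (fst (fst x)) (snd (fst x))"
        and b = "\<lambda>x. Copy (fst (fst x)) (snd x)"])
    show "inj_on (\<lambda>x. {Port (fst (fst x)) (snd (fst x)), Copy (fst (fst x)) (snd x)}) (mismatch C \<times> {..<r})"
      by (auto simp: inj_on_def doubleton_eq_iff)
  next
    fix x assume "x \<in> mismatch C \<times> {..<r}"
    then obtain v e i where x: "x = ((v, e), i)" "(v, e) \<in> mismatch C" "i < r" by auto
    then show "Port (fst (fst x)) (snd (fst x)) \<in> nodes \<and> Copy (fst (fst x)) (snd x) \<in> nodes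
       \<and> (Port (fst (fst x)) (snd (fst x)) \<in> C) \<noteq> (Copy (fst (fst x)) (snd x) \<in> C)"
      using side_Copy[OF C lt] unfolding mismatch_def by auto
  qed (use fin_nodes C w1_nonneg w1_sym fin_mismatch in auto)
  then show ?thesis by (simp only: card_cartesian_product card_lessThan of_nat_mult) (simp add: mult_ac)
qed

lemma cut_severed:
  assumes C: "C \<subseteq> nodes"
  shows "real (card (severed C)) * \<kappa> \<le> cut_weight nodes w2 C"
proof -
  have "\<forall>e\<in>severed C. \<exists>u v. u \<in> e \<and> v \<in> e \<and> Port u e \<in> C \<and> Port v e \<notin> C"
    unfolding severed_def by blast
  then obtain u v where uv: "\<And>e. e \<in> severed C \<Longrightarrow> u e \<in> e \<and> v e \<in> e \<and> Port (u e) e \<in> C \<and> Port (v e) e \<notin> C"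
    by metis
  show ?thesis
  proof (rule cut_weight_ge[where a = "\<lambda>e. Port (u e) e" and b = "\<lambda>e. Port (v e) e"])
    show "inj_on (\<lambda>e. {Port (u e) e, Port (v e) e}) (severed C)"
      by (auto simp: inj_on_def doubleton_eq_iff)
    show "finite (severed C)" unfolding severed_def using fin_inner by simp
  next
    fix e assume e: "e \<in> severed C"
    then have "e \<in> E" "e \<subseteq> K" unfolding severed_def inner_def by auto
    then show "Port (u e) e \<in> nodes \<and> Port (v e) e \<in> nodes \<and> (Port (u e) e \<in> C) \<noteq> (Port (v e) e \<in> C)"
      using uv[OF e] unfolding nodes_Port inc_def by blast
    show "\<kappa> \<le> w2 (Port (u e) e) (Port (v e) e)" using uv[OF e] by auto
  qed (use fin_nodes C w2_nonneg w2_sym in auto)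
qed

text \<open>Splitting a clique on m ports cuts at least m - 1 of its edges: every port other than
  that of \<open>e\<close> is joined to the port of \<open>e\<close> or of \<open>f\<close>,
  whichever lies on the other side. Each of these edges has weight \<kappa>/(m - 1).\<close>

lemma cut_clique:
  assumes C: "C \<subseteq> nodes" and e: "e \<in> bd" "Port u e \<in> C" and f: "f \<in> bd" "Port v f \<in> nodes" "Port v f \<notin> C"
  shows "\<kappa> \<le> cut_weight nodes w3 C"
proof -
  have "\<forall>g\<in>bd. \<exists>x. x \<in> K \<and> g \<in> inc x"
    unfolding bd_def inc_def by auto
  then obtain x where x: "\<And>g. g \<in> bd \<Longrightarrow> x g \<in> K \<and> g \<in> inc (x g)" by metis
  have u: "u \<in> K" "u \<in> e" and v: "v \<in> K" "v \<in> f" using e f C unfolding inc_def by (auto simp: inc_def)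
  have xe: "x e = u" using bd_end_unique[OF e(1), of "x e" u] x[OF e(1)] u unfolding inc_def by auto
  have xf: "x f = v" using bd_end_unique[OF f(1), of "x f" v] x[OF f(1)] v unfolding inc_def by auto
  have ef: "e \<noteq> f" using xe xf e f by auto
  define b where "b g = (if Port (x g) g \<in> C then Port v f else Port u e)" for g
  have "real (card (bd - {e})) * (\<kappa> / (real (card bd) - 1)) \<le> cut_weight nodes w3 C"
  proof (rule cut_weight_ge[where a = "\<lambda>g. Port (x g) g" and b = b])
    show "inj_on (\<lambda>g. {Port (x g) g, b g}) (bd - {e})"
      using e f xf unfolding b_def by (auto simp: inj_on_def doubleton_eq_iff split: if_splits)
  next
    fix g assume g: "g \<in> bd - {e}"
    show "Port (x g) g \<in> nodes \<and> b g \<in> nodes \<and> (Port (x g) g \<in> C) \<noteq> (b g \<in> C)"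
      using x[of g] g e f C unfolding b_def by auto
    show "\<kappa> / (real (card bd) - 1) \<le> w3 (Port (x g) g) (b g)"
      using g e(1) f xf unfolding b_def by auto
  qed (use fin_nodes C w3_nonneg w3_sym fin_bd in auto)
  moreover have "card bd \<ge> 2"
    using card_mono[OF fin_bd, of "{e, f}"] e f ef by simp
  moreover have "card (bd - {e}) = card bd - 1" using e(1) by (rule card_Diff_singleton)
  ultimately show ?thesis by (simp add: of_nat_diff)
qed

lemma card_port_part:
  "card {(v, e). v \<in> K \<and> e \<in> inc v \<and> v \<in> W} = d * card (W \<inter> K)"
proof -
  have "{(v, e). v \<in> K \<and> e \<in> inc v \<and> v \<in> W} = (SIGMA v:W \<inter> K. inc v)" by auto
  then show ?thesis using finK fin_inc card_inc by (simp add: card_SigmaI)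
qed

lemma card_cut_side:
  assumes C: "C \<subseteq> nodes" and lt: "cut_weight nodes w C < 1"
  shows "card C = r * card (side C) + card {(v, e). v \<in> K \<and> e \<in> inc v \<and> Port v e \<in> C}"
proof -
  let ?P = "{(v, e). v \<in> K \<and> e \<in> inc v \<and> Port v e \<in> C}"
  have side: "side C \<subseteq> K" unfolding side_def by auto
  have eq: "C = case_prod Copy ` (side C \<times> {..<r}) \<union> case_prod Port ` ?P"
  proof (intro equalityI subsetI)
    fix x assume x: "x \<in> C"
    show "x \<in> case_prod Copy ` (side C \<times> {..<r}) \<union> case_prod Port ` ?P"
    proof (cases x)
      case (Copy v i)
      then have "v \<in> K" "i < r" using x C by auto
      then have "v \<in> side C" using side_Copy[OF C lt] x Copy by blast
      then show ?thesis using Copy \<open>i < r\<close> by force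
    next
      case (Port v e)
      then have "(v, e) \<in> ?P" using x C by auto
      then show ?thesis using Port by force
    qed
  qed (use side_Copy[OF C lt] side in auto)
  have "finite ?P" by (rule finite_subset[of _ "SIGMA v:K. inc v"]) (use finK fin_inc in auto)
  moreover have "finite (side C)" using finite_subset[OF side finK] .
  ultimately have "card C = card (case_prod Copy ` (side C \<times> {..<r})) + card (case_prod Port ` ?P)"
    by (subst eq, intro card_Un_disjoint) auto
  also have "\<dots> = r * card (side C) + card ?P"
    by (simp only: card_image[OF inj_Copy] card_image[OF inj_Port] card_cartesian_product card_lessThan mult.commute)
  finally show ?thesis .
qed

text \<open>The mismatches are the symmetric difference of the set of ports in \<open>C\<close> and
  the set of ports at vertices of \<open>side C\<close>, which has \<open>d * card (side C)\<close>
  elements.\<close>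

lemma mismatch_parity:
  "odd (card (mismatch C)) \<longleftrightarrow> odd (card {(v, e). v \<in> K \<and> e \<in> inc v \<and> Port v e \<in> C} + d * card (side C))"
proof -
  let ?P = "{(v, e). v \<in> K \<and> e \<in> inc v \<and> Port v e \<in> C}"
  let ?Q = "{(v, e). v \<in> K \<and> e \<in> inc v \<and> v \<in> side C}"
  have fin: "finite ?P" "finite ?Q"
    by (rule finite_subset[of _ "SIGMA v:K. inc v"]; use finK fin_inc in auto)+
  have "mismatch C = (?P - ?Q) \<union> (?Q - ?P)" unfolding mismatch_def by auto
  then have "card (mismatch C) = card (?P - ?Q) + card (?Q - ?P)"
    using fin by (simp only:) (rule card_Un_disjoint; auto)
  moreover have "card ?P = card (?P - ?Q) + card (?P \<inter> ?Q)"
    using fin card_Diff_subset_Int[of ?P ?Q] card_mono[of ?P "?P \<inter> ?Q"] by auto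
  moreover have "card ?Q = card (?Q - ?P) + card (?P \<inter> ?Q)"
    using fin card_Diff_subset_Int[of ?Q ?P] card_mono[of ?Q "?P \<inter> ?Q"] by (auto simp: Int_commute)
  moreover have "card ?Q = d * card (side C)"
    using card_port_part[of "side C"] unfolding side_def by (simp add: Int_def conj_ac)
  ultimately show ?thesis by auto
qed

lemma severed_not_iff:
  assumes "e \<in> inner" "e \<notin> severed C" "u \<in> e" "v \<in> e"
  shows "Port u e \<in> C \<longleftrightarrow> Port v e \<in> C"
  using assms unfolding severed_def by blast

lemma mismatch_not_iff:
  assumes "(v, e) \<notin> mismatch C" "v \<in> K" "e \<in> E" "v \<in> e"
  shows "Port v e \<in> C \<longleftrightarrow> v \<in> side C"
  using assms unfolding mismatch_def inc_def by blast

text \<open>In a cut of weight less than 1 the number of mismatches is odd, hence 1. The remaining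
  weight is below 1 - r/d = \<kappa>, so no inner edge is severed and the edges crossing
  \<open>side C\<close> are at most the mismatched one. By \<open>conn\<close> the side is trivial,
  and the mismatch sits at a boundary edge; any second boundary edge then splits the clique, which
  costs \<kappa>.\<close>

lemma odd_cut_odd:
  assumes odd: "odd d" "odd r" "d \<le> 3 * r"
    and conn: "\<And>W. W \<subseteq> K \<Longrightarrow> W \<noteq> {} \<Longrightarrow> W \<noteq> K \<Longrightarrow> card (cross W) \<ge> 2"
    and C: "C \<subseteq> nodes" "odd (card C)"
    and single: "card bd = 1 \<Longrightarrow> (\<exists>v\<in>K. Copy v 0 \<notin> C) \<and> (\<forall>v. \<forall>e\<in>bd. Port v e \<notin> C)"
  shows "cut_weight nodes w C \<ge> 1"
proof (rule ccontr)
  assume "\<not> ?thesis"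
  then have lt: "cut_weight nodes w C < 1" by simp
  have bound: "real (card (mismatch C)) * (real r / real d) + real (card (severed C)) * \<kappa>
      + cut_weight nodes w3 C < 1"
    using lt cut_mismatch[OF C(1) lt] cut_severed[OF C(1)] cut_weight_split[of C] by linarith
  have w3: "cut_weight nodes w3 C \<ge> 0" by (rule cut_weight_nonneg[OF w3_nonneg])
  have pos: "real r / real d > 0" using r by simp
  have "card C = r * card (side C) + card {(v, e). v \<in> K \<and> e \<in> inc v \<and> Port v e \<in> C}"
    by (rule card_cut_side[OF C(1) lt])
  then have "odd (card (mismatch C))" unfolding mismatch_parity using C(2) odd by auto
  moreover have "card (mismatch C) < 3"
  proof (rule ccontr)
    assume "\<not> card (mismatch C) < 3"
    then have "3 * (real r / real d) \<le> real (card (mismatch C)) * (real r / real d)"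
      using pos by (intro mult_right_mono) auto
    \<comment> \<open>Here \<open>d \<le> 3 * r\<close> is what forbids three mismatches.\<close>
    moreover have "3 * (real r / real d) \<ge> 1" using odd(3) r by (simp add: field_simps)
    moreover have "real (card (severed C)) * \<kappa> \<ge> 0" using kappa_pos by simp
    ultimately show False using bound w3 by linarith
  qed
  ultimately have m1: "card (mismatch C) = 1" by presburger
  then obtain x where "mismatch C = {x}" by (rule card_1_singletonE)
  then obtain v1 e1 where ve: "mismatch C = {(v1, e1)}" by (cases x) simp
  then have "(v1, e1) \<in> mismatch C" by simp
  then have v1: "v1 \<in> K" "e1 \<in> E" "v1 \<in> e1" "e1 \<in> inc v1" "(Port v1 e1 \<in> C) \<noteq> (v1 \<in> side C)"
    unfolding mismatch_def inc_def by auto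
  have "real (card (severed C)) * \<kappa> + cut_weight nodes w3 C < \<kappa>"
    using bound kappa_r unfolding m1 by simp
  moreover have "card (severed C) = 0"
  proof (rule ccontr)
    assume "card (severed C) \<noteq> 0"
    then have "1 * \<kappa> \<le> real (card (severed C)) * \<kappa>"
      using kappa_pos by (intro mult_right_mono) auto
    then show False using calculation w3 by linarith
  qed
  ultimately have w3lt: "cut_weight nodes w3 C < \<kappa>" by simp
  have "finite (severed C)" unfolding severed_def using fin_inner by simp
  then have sev: "severed C = {}" using \<open>card (severed C) = 0\<close> by simp
  have side: "side C \<subseteq> K" unfolding side_def by auto
  \<comment> \<open>Both ports of an inner edge lie on the same side of the cut, so its ends
    disagree exactly when one of its ports is mismatched.\<close>
  have cross_eq: "cross (side C) = (if e1 \<in> inner then {e1} else {})"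
  proof (rule set_eqI)
    fix e
    show "e \<in> cross (side C) \<longleftrightarrow> e \<in> (if e1 \<in> inner then {e1} else {})"
    proof (cases "e \<in> inner")
      case True
      then have e: "e \<in> E" "e \<subseteq> K" unfolding inner_def by auto
      have port: "Port u e \<in> C \<longleftrightarrow> Port v e \<in> C" if "u \<in> e" "v \<in> e" for u v
        using severed_not_iff[OF True] sev that by blast
      show ?thesis
      proof (cases "e = e1")
        case eq: True
        obtain u where u: "e1 = {v1, u}" "u \<noteq> v1" using card_2_other[OF card_edge[OF v1(2)] v1(3)] .
        then have "Port u e1 \<in> C \<longleftrightarrow> u \<in> side C"
          using mismatch_not_iff[of u e1 C] ve v1 e eq by auto
        then have "u \<in> side C \<longleftrightarrow> v1 \<notin> side C" using port[of u v1] u v1 eq by blast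
        then show ?thesis using True eq u unfolding cross_def by auto
      next
        case False
        then have "Port u e \<in> C \<longleftrightarrow> u \<in> side C" if "u \<in> e" for u
          using mismatch_not_iff[of u e C] ve e that by auto
        then have "u \<in> side C \<longleftrightarrow> v \<in> side C" if "u \<in> e" "v \<in> e" for u v using port that by blast
        then have "e \<notin> cross (side C)" unfolding cross_def by blast
        then show ?thesis using False by simp
      qed
    next
      case False
      then show ?thesis unfolding cross_def by auto
    qed
  qed
  then have "card (cross (side C)) \<le> 1" by (simp split: if_splits)
  then have triv: "side C = {} \<or> side C = K" using conn[OF side] by fastforce
  then have "cross (side C) = {}" unfolding cross_def inner_def by auto
  then have "e1 \<notin> inner" using cross_eq by (auto split: if_splits)
  then have e1: "e1 \<in> bd" using inc_cases v1 by blast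
  show False
  proof (cases "card bd = 1")
    case True
    then obtain v where "v \<in> K" "Copy v 0 \<notin> C" using single by blast
    \<comment> \<open>The cut around the only boundary port has weight r/d < 1, and so does the cut
      around all other nodes. The two parts of \<open>single\<close> exclude these two
      cases.\<close>
    then have "side C = {}" using triv unfolding side_def by blast
    then show False using v1 single[OF True] e1 by blast
  next
    case False
    have "bd \<noteq> {e1}" using False by auto
    then obtain f where f: "f \<in> bd" "f \<noteq> e1" using e1 by blast
    then obtain u where u: "u \<in> K" "u \<in> f" "f \<in> E" unfolding bd_def by blast
    have "Port u f \<in> C \<longleftrightarrow> u \<in> side C" using mismatch_not_iff[of u f C] u ve f by auto
    then have diff: "(Port u f \<in> C) \<noteq> (Port v1 e1 \<in> C)" using v1 u triv by auto
    have "\<kappa> \<le> cut_weight nodes w3 C"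
    proof (cases "Port u f \<in> C")
      case True
      then show ?thesis using cut_clique[OF C(1) f(1) True e1] diff v1 by auto
    next
      case F: False
      then show ?thesis using cut_clique[OF C(1) e1 _ f(1), of v1 u] diff u unfolding nodes_Port inc_def by auto
    qed
    then show False using w3lt by simp
  qed
qed

text \<open>Count the ports in \<open>C\<close> by edges: boundary edges contribute none, and an
  inner edge contributes an odd number exactly when it is severed.\<close>

lemma severed_parity:
  assumes out: "\<And>v e. e \<in> bd \<Longrightarrow> Port v e \<notin> C"
  shows "odd (card (severed C)) \<longleftrightarrow> odd (card {(v, e). v \<in> K \<and> e \<in> inc v \<and> Port v e \<in> C})"
proof -
  let ?P = "{(v, e). v \<in> K \<and> e \<in> inc v \<and> Port v e \<in> C}"
  have inj: "inj_on prod.swap ?P" by (auto simp: inj_on_def)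
  have "prod.swap ` ?P = (SIGMA e:inner. {v\<in>e. Port v e \<in> C})"
  proof (intro equalityI subsetI)
    fix x assume "x \<in> prod.swap ` ?P"
    then obtain v e where x: "x = (e, v)" "v \<in> K" "e \<in> inc v" "Port v e \<in> C" by auto
    then have "e \<in> inner" using inc_cases out by blast
    then show "x \<in> (SIGMA e:inner. {v\<in>e. Port v e \<in> C})" using x unfolding inc_def by auto
  next
    fix x assume "x \<in> (SIGMA e:inner. {v\<in>e. Port v e \<in> C})"
    then obtain v e where "x = (e, v)" "e \<in> inner" "v \<in> e" "Port v e \<in> C" by auto
    then have "x = prod.swap (v, e)" "(v, e) \<in> ?P" unfolding inner_def inc_def by auto
    then show "x \<in> prod.swap ` ?P" by (rule image_eqI)
  qed
  moreover have fin_e: "finite e" if "e \<in> inner" for e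
    using that card_edge[of e] unfolding inner_def by (metis (no_types, lifting) card.infinite mem_Collect_eq zero_neq_numeral)
  ultimately have "card ?P = (\<Sum>e\<in>inner. card {v\<in>e. Port v e \<in> C})"
    using card_image[OF inj] fin_inner by (simp add: card_SigmaI)
  moreover have "{e\<in>inner. odd (card {v\<in>e. Port v e \<in> C})} = severed C"
  proof -
    have "odd (card {v\<in>e. Port v e \<in> C}) \<longleftrightarrow> (\<exists>u\<in>e. \<exists>v\<in>e. Port u e \<in> C \<and> Port v e \<notin> C)" if "e \<in> inner" for e
    proof -
      have "card e = 2" using that card_edge unfolding inner_def by blast
      then obtain x y where xy: "e = {x, y}" "x \<noteq> y" by (meson card_2_iff)
      have "{v\<in>e. Port v e \<in> C} = (if Port x e \<in> C then {x} else {}) \<union> (if Port y e \<in> C then {y} else {})"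
        unfolding xy(1) by auto
      then show ?thesis using xy by auto
    qed
    then show ?thesis unfolding severed_def by blast
  qed
  ultimately show ?thesis using even_sum_iff[OF fin_inner, of "\<lambda>e. card {v\<in>e. Port v e \<in> C}"] by simp
qed

text \<open>Two copies per vertex do not affect parity, so here the number of severed edges is odd.
  Three of them cost 3\<kappa> \<ge> 1, hence there is one; any mismatch would raise the total to
  \<kappa> + r/d = 1. Without mismatches the severed edge is the only edge crossing
  \<open>side C\<close>.\<close>

lemma odd_cut_two:
  assumes r2: "r = 2"
    and nosep: "\<And>W. W \<subseteq> K \<Longrightarrow> card (cross W) \<noteq> 1"
    and C: "C \<subseteq> nodes" "odd (card C)"
    and out: "\<And>v e. e \<in> bd \<Longrightarrow> Port v e \<notin> C"
  shows "cut_weight nodes w C \<ge> 1"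
proof (rule ccontr)
  assume "\<not> ?thesis"
  then have lt: "cut_weight nodes w C < 1" by simp
  have bound: "real (card (mismatch C)) * (real r / real d) + real (card (severed C)) * \<kappa> < 1"
    using lt cut_mismatch[OF C(1) lt] cut_severed[OF C(1)] cut_weight_split[of C]
      cut_weight_nonneg[of w3 nodes C, OF w3_nonneg] by linarith
  have pos: "real r / real d > 0" using r by simp
  have "card C = 2 * card (side C) + card {(v, e). v \<in> K \<and> e \<in> inc v \<and> Port v e \<in> C}"
    using card_cut_side[OF C(1) lt] r2 by simp
  then have odd_sev: "odd (card (severed C))" using severed_parity[OF out] C(2) by auto
  moreover have "card (severed C) < 3"
  proof (rule ccontr)
    assume "\<not> card (severed C) < 3"
    then have "3 * \<kappa> \<le> real (card (severed C)) * \<kappa>"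
      using kappa_pos by (intro mult_right_mono) auto
    moreover have "3 * \<kappa> \<ge> 1" using r r2 unfolding \<kappa>_def by (simp add: field_simps)
    moreover have "real (card (mismatch C)) * (real r / real d) \<ge> 0" by simp
    ultimately show False using bound by linarith
  qed
  ultimately have s1: "card (severed C) = 1" by presburger
  have "card (mismatch C) = 0"
  proof (rule ccontr)
    assume "card (mismatch C) \<noteq> 0"
    then have "1 * (real r / real d) \<le> real (card (mismatch C)) * (real r / real d)"
      using pos by (intro mult_right_mono) auto
    then show False using bound kappa_r unfolding s1 by simp
  qed
  then have mis: "mismatch C = {}" using fin_mismatch by simp
  have "severed C = cross (side C)"
  proof -
    have "e \<in> severed C \<longleftrightarrow> e \<in> cross (side C)" if "e \<in> inner" for e
    proof -
      have "Port u e \<in> C \<longleftrightarrow> u \<in> side C" if "u \<in> e" for u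
        using mismatch_not_iff[of u e C] mis that \<open>e \<in> inner\<close> unfolding inner_def by blast
      then show ?thesis using that unfolding severed_def cross_def by blast
    qed
    then show ?thesis unfolding severed_def cross_def by blast
  qed
  then show False using s1 nosep[of "side C"] unfolding side_def by simp
qed

text \<open>An inner edge whose two ports are matched to each other is not used.\<close>

lemma matching_factor:
  assumes M: "matching (support_graph nodes w) M"
    and copies: "\<And>v i. v \<in> K \<Longrightarrow> i < r \<Longrightarrow> Copy v i \<in> \<Union>M"
    and ports: "\<And>v e. v \<in> K \<Longrightarrow> e \<in> inc v \<Longrightarrow> e \<in> inner \<Longrightarrow> Port v e \<in> \<Union>M"
  defines "F \<equiv> {e\<in>E. \<exists>v\<in>K. \<exists>i<r. {Copy v i, Port v e} \<in> M}"
  shows "\<And>v. v \<in> K \<Longrightarrow> degree F v = r"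
proof -
  have edge: "\<exists>b. m = {a, b} \<and> a \<in> nodes \<and> b \<in> nodes \<and> a \<noteq> b \<and> w a b > 0" if m: "m \<in> M" "a \<in> m" for m a
  proof -
    have "m \<in> support_graph nodes w" using M m(1) unfolding matching_def by blast
    then obtain x y where xy: "m = {x, y}" "x \<in> nodes" "y \<in> nodes" "x \<noteq> y" "w x y > 0"
      unfolding support_graph_def by blast
    then consider "a = x" | "a = y" using m(2) by blast
    then show ?thesis
    proof cases
      case 1
      then show ?thesis using xy by blast
    next
      case 2
      then have "m = {a, x}" "w a x > 0" using xy w_sym[of x y] by auto
      then show ?thesis using xy 2 by blast
    qed
  qed
  have uniq: "m = m'" if "m \<in> M" "m' \<in> M" "a \<in> m" "a \<in> m'" for m m' a
    using matching_unique[OF M] that by blast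
  fix v assume v: "v \<in> K"
  have "\<exists>e. e \<in> inc v \<and> {Copy v i, Port v e} \<in> M" if i: "i < r" for i
  proof -
    obtain m where m: "m \<in> M" "Copy v i \<in> m" using copies[OF v i] by blast
    then obtain b where b: "m = {Copy v i, b}" "b \<in> nodes" "w (Copy v i) b > 0" using edge by metis
    then obtain u e where "b = Port u e" "u = v" unfolding w_def by (cases b) (auto split: if_splits)
    then show ?thesis using b m by auto
  qed
  then obtain g where g: "\<And>i. i < r \<Longrightarrow> g i \<in> inc v \<and> {Copy v i, Port v (g i)} \<in> M" by metis
  have "inj_on g {..<r}"
  proof (rule inj_onI)
    fix i j assume ij: "i \<in> {..<r}" "j \<in> {..<r}" "g i = g j"
    then have "{Copy v i, Port v (g i)} \<in> M" "{Copy v j, Port v (g j)} \<in> M"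
      using g[of i] g[of j] ij(1,2) by simp_all
    then have "{Copy v i, Port v (g i)} = {Copy v j, Port v (g j)}"
      using ij(3) by (intro uniq[of _ _ "Port v (g i)"]) auto
    then show "i = j" using ij(3) by (simp add: doubleton_eq_iff)
  qed
  moreover have "g ` {..<r} = {e\<in>F. v \<in> e}"
  proof (intro equalityI subsetI)
    fix e assume "e \<in> g ` {..<r}"
    then show "e \<in> {e\<in>F. v \<in> e}" using g v unfolding F_def inc_def by blast
  next
    fix e assume "e \<in> {e\<in>F. v \<in> e}"
    then obtain u j where e: "e \<in> E" "v \<in> e" "u \<in> K" "j < r" and uj: "{Copy u j, Port u e} \<in> M"
      unfolding F_def by blast
    have "Port u e \<in> nodes"
      using edge[OF uj, of "Port u e"] by blast
    then have ue: "u \<in> e" unfolding nodes_Port inc_def by blast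
    have "\<exists>i<r. {Copy v i, Port v e} \<in> M"
    proof (cases "u = v")
      case True
      then show ?thesis using uj e by blast
    next
      case False
      \<comment> \<open>Only the port at \<open>u\<close> is known to be matched to a copy. The port
        at \<open>v\<close> is covered too and its twin is taken, so it is matched to a copy of
        \<open>v\<close>.\<close>
      then have e_eq: "e = {u, v}" using card_2_other[OF card_edge[OF e(1)] ue] e(2) by (metis insertE singletonD)
      then have inn: "e \<in> inner" using e v unfolding inner_def by auto
      have "e \<in> inc v" using e unfolding inc_def by auto
      then obtain m where m: "m \<in> M" "Port v e \<in> m" using ports[OF v _ inn] by blast
      then obtain b where b: "m = {Port v e, b}" "b \<in> nodes" "w (Port v e) b > 0" using edge by metis
      show ?thesis
      proof (cases b)
        case (Copy x i)
        then have "x = v" using b(3) unfolding w_def by (simp split: if_splits)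
        then have "m = {Copy v i, Port v e}" "i < r" using b(1,2) Copy by auto
        then show ?thesis using m by blast
      next
        case (Port x f)
        then have "f = e" "x \<noteq> v"
          using b(3) inner_bd_disjoint[OF inn] unfolding w_def by (auto split: if_splits)
        then have "x \<in> e" using b(2) Port by (simp add: inc_def)
        then have "x = u" using \<open>x \<noteq> v\<close> e_eq by blast
        then have "m = {Copy u j, Port u e}"
          using uniq[OF m(1) uj, of "Port u e"] b(1) Port \<open>f = e\<close> by blast
        then have "Port v e \<in> {Copy u j, Port u e}" using m(2) by simp
        then show ?thesis using False by simp
      qed
    qed
    then obtain i where i: "i < r" "{Copy v i, Port v e} \<in> M" by blast
    then have "{Copy v i, Port v e} = {Copy v i, Port v (g i)}"
      using uniq[of "{Copy v i, Port v e}" "{Copy v i, Port v (g i)}" "Copy v i"] g by blast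
    then have "e = g i" by (simp add: doubleton_eq_iff)
    then show "e \<in> g ` {..<r}" using i(1) by blast
  qed
  ultimately have "card {e\<in>F. v \<in> e} = r" using card_image by fastforce
  then show "degree F v = r" unfolding degree_def .
qed

section \<open>Factors obtained by rounding the gadget\<close>

lemma support_edge: "a \<in> nodes \<Longrightarrow> b \<in> nodes \<Longrightarrow> a \<noteq> b \<Longrightarrow> w a b > 0 \<Longrightarrow> {a, b} \<in> support_graph nodes w"
  unfolding support_graph_def by blast

lemma rounding:
  assumes "B \<subseteq> nodes" "even (card (nodes - B))" "real (card B) - (\<Sum>a\<in>B. \<Sum>b\<in>B. w a b) < 2"
    and "\<And>C. C \<subseteq> nodes - B \<Longrightarrow> odd (card C) \<Longrightarrow> cut_weight nodes w C \<ge> 1"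
  shows "\<exists>M. matching (support_graph nodes w) M \<and> \<Union>M = nodes - B"
proof (rule fractional_matching_rounding)
  show "w a b \<ge> 0" for a b by (rule w_nonneg)
  show "w a b = w b a" for a b by (rule w_sym)
  show "(\<Sum>b\<in>nodes. w a b) \<le> 1" if "a \<in> nodes" for a using that by (rule row_sum_le_1)
qed (fact fin_nodes assms)+

text \<open>The two deleted nodes count 2 in the barrier, and the positive weight between them
  brings the bound strictly below 2. The edge joining them is added afterwards.\<close>

lemma rounding_pair:
  assumes ab: "a \<in> nodes" "b \<in> nodes" "a \<noteq> b" "w a b > 0" and even: "even (card nodes)"
    and cut: "\<And>C. C \<subseteq> nodes - {a, b} \<Longrightarrow> odd (card C) \<Longrightarrow> cut_weight nodes w C \<ge> 1"
  shows "\<exists>M. matching (support_graph nodes w) M \<and> \<Union>M = nodes \<and> {a, b} \<in> M"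
proof -
  have "(\<Sum>x\<in>{a, b}. \<Sum>y\<in>{a, b}. w x y) = w a a + w a b + (w b a + w b b)" using ab(3) by simp
  then have pos: "(\<Sum>x\<in>{a, b}. \<Sum>y\<in>{a, b}. w x y) > 0"
    using ab(4) w_nonneg[of a a] w_nonneg[of b a] w_nonneg[of b b] by linarith
  have card: "card {a, b} = 2" "{a, b} \<subseteq> nodes" using ab by auto
  then have "card (nodes - {a, b}) = card nodes - 2" by (simp only: card_Diff_subset finite.intros)
  then have "even (card (nodes - {a, b}))" using even by simp
  moreover have "real (card {a, b}) - (\<Sum>x\<in>{a, b}. \<Sum>y\<in>{a, b}. w x y) < 2" using pos card by linarith
  ultimately have "\<exists>M. matching (support_graph nodes w) M \<and> \<Union>M = nodes - {a, b}"
    using rounding[OF card(2) _ _ cut] by simp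
  then obtain M where M: "matching (support_graph nodes w) M" "\<Union>M = nodes - {a, b}" by blast
  show ?thesis
    using matching_add_edge[OF M(1) support_edge[OF ab] M(2) card(2)] by blast
qed

text \<open>Matching the port of \<open>e\<close> to a copy of its end forces \<open>e\<close> into
  the factor. If \<open>e\<close> is the only boundary edge, the deletion of these two nodes also
  provides the extra condition of \<open>odd_cut_odd\<close>.\<close>

lemma factor_through:
  assumes odd: "odd d" "odd r" "d \<le> 3 * r"
    and conn: "\<And>W. W \<subseteq> K \<Longrightarrow> W \<noteq> {} \<Longrightarrow> W \<noteq> K \<Longrightarrow> card (cross W) \<ge> 2"
    and e: "e \<in> bd"
  shows "\<exists>F\<subseteq>inner \<union> bd. e \<in> F \<and> (\<forall>v\<in>K. degree F v = r)"
proof -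
  obtain v where v: "v \<in> K" "v \<in> e" "e \<in> E" using e unfolding bd_def by blast
  then have ev: "e \<in> inc v" unfolding inc_def by auto
  have "w (Copy v 0) (Port v e) > 0" unfolding w_def using r by simp
  moreover have "even (card nodes)" unfolding card_nodes using odd by simp
  ultimately have "\<exists>M. matching (support_graph nodes w) M \<and> \<Union>M = nodes \<and> {Copy v 0, Port v e} \<in> M"
  proof (intro rounding_pair)
    fix C assume C: "C \<subseteq> nodes - {Copy v 0, Port v e}" "odd (card C)"
    show "cut_weight nodes w C \<ge> 1"
    proof (rule odd_cut_odd[OF odd conn])
      assume "card bd = 1"
      then have bd: "bd = {e}" using e by (metis card_1_singletonE singletonD)
      have "Port u f \<notin> C" if "f \<in> bd" for u f
      proof
        assume *: "Port u f \<in> C"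
        then have "Port u f \<in> nodes" using C(1) by blast
        then have uf: "u \<in> K" "u \<in> f" unfolding nodes_Port inc_def by blast+
        have "f = e" using that unfolding bd by simp
        then have "u = v" using bd_end_unique[OF e _ _ v(2,1)] uf by simp
        then show False using * C(1) \<open>f = e\<close> by blast
      qed
      moreover have "Copy v 0 \<notin> C" using C(1) by blast
      ultimately show "(\<exists>v\<in>K. Copy v 0 \<notin> C) \<and> (\<forall>v. \<forall>e\<in>bd. Port v e \<notin> C)" using v(1) by blast
    qed (use C in auto)
  qed (use v ev r in auto)
  then obtain M where M: "matching (support_graph nodes w) M" "\<Union>M = nodes" "{Copy v 0, Port v e} \<in> M"
    by blast
  define F where "F = {e\<in>E. \<exists>v\<in>K. \<exists>i<r. {Copy v i, Port v e} \<in> M}"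
  have "\<forall>v\<in>K. degree F v = r" unfolding F_def using matching_factor[OF M(1)] M(2) by simp
  moreover have "e \<in> F" unfolding F_def using v M(3) r by blast
  moreover have "F \<subseteq> inner \<union> bd"
  proof
    fix f assume "f \<in> F"
    then obtain u i where "u \<in> K" "{Copy u i, Port u f} \<in> M" unfolding F_def by blast
    then have "Port u f \<in> nodes" using M(2) by blast
    then show "f \<in> inner \<union> bd" using inc_cases by auto
  qed
  ultimately show ?thesis by blast
qed

lemma factor_avoiding:
  assumes odd: "odd d" "odd r" "d \<le> 3 * r"
    and conn: "\<And>W. W \<subseteq> K \<Longrightarrow> W \<noteq> {} \<Longrightarrow> W \<noteq> K \<Longrightarrow> card (cross W) \<ge> 2"
    and e: "e \<in> bd" and two: "card bd \<ge> 2"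
  shows "\<exists>F\<subseteq>inner \<union> bd. e \<notin> F \<and> (\<forall>v\<in>K. degree F v = r)"
proof -
  obtain f where f: "f \<in> bd" "f \<noteq> e"
  proof -
    have "\<not> bd \<subseteq> {e}"
    proof
      assume "bd \<subseteq> {e}"
      then have "card bd \<le> card {e}" by (intro card_mono) auto
      then show False using two by simp
    qed
    then show thesis using that by blast
  qed
  obtain u where u: "u \<in> K" "u \<in> f" "f \<in> E" using f unfolding bd_def by blast
  obtain v where v: "v \<in> K" "v \<in> e" "e \<in> E" using e unfolding bd_def by blast
  then have inc: "e \<in> inc v" "f \<in> inc u" using u unfolding inc_def by auto
  have "w (Port v e) (Port u f) > 0" unfolding w_def using f e two kappa_pos by simp
  moreover have "even (card nodes)" unfolding card_nodes using odd by simp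
  ultimately have "\<exists>M. matching (support_graph nodes w) M \<and> \<Union>M = nodes \<and> {Port v e, Port u f} \<in> M"
  proof (intro rounding_pair)
    fix C assume C: "C \<subseteq> nodes - {Port v e, Port u f}" "odd (card C)"
    show "cut_weight nodes w C \<ge> 1"
      by (rule odd_cut_odd[OF odd conn]) (use C two in auto)
  qed (use v u f inc in auto)
  then obtain M where M: "matching (support_graph nodes w) M" "\<Union>M = nodes" "{Port v e, Port u f} \<in> M"
    by blast
  define F where "F = {e\<in>E. \<exists>v\<in>K. \<exists>i<r. {Copy v i, Port v e} \<in> M}"
  have "\<forall>v\<in>K. degree F v = r" unfolding F_def using matching_factor[OF M(1)] M(2) by simp
  moreover have "e \<notin> F"
  proof
    assume "e \<in> F"
    then obtain x i where x: "x \<in> K" "{Copy x i, Port x e} \<in> M" unfolding F_def by blast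
    then have "Port x e \<in> nodes" using M(2) by blast
    then have "x = v" using bd_end_unique[OF e] v unfolding nodes_Port inc_def by blast
    then have "{Copy x i, Port x e} = {Port v e, Port u f}"
      by (intro matching_unique[OF M(1) x(2) M(3), of "Port v e"]) simp_all
    then show False by (simp add: doubleton_eq_iff)
  qed
  moreover have "F \<subseteq> inner \<union> bd"
  proof
    fix f assume "f \<in> F"
    then obtain u i where "u \<in> K" "{Copy u i, Port u f} \<in> M" unfolding F_def by blast
    then have "Port u f \<in> nodes" using M(2) by blast
    then show "f \<in> inner \<union> bd" using inc_cases by auto
  qed
  ultimately show ?thesis by blast
qed

lemma degree_count: "d * card K = 2 * card inner + card bd"
proof -
  have one: "card (e \<inter> K) = 1" if "e \<in> bd" for e
    using bd_end[OF that] by (metis is_singletonI is_singleton_altdef)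
  have "d * card K = (\<Sum>v\<in>K. \<Sum>e\<in>inc v. 1)" using card_inc by simp
  also have "\<dots> = (\<Sum>e\<in>E. card (e \<inter> K))" using sum_inc[of "\<lambda>_. 1 :: nat"] by simp
  also have "\<dots> = (\<Sum>e\<in>inner \<union> bd. card (e \<inter> K))"
    using finE by (intro sum.mono_neutral_right) (auto simp: inner_def bd_def)
  also have "\<dots> = (\<Sum>e\<in>inner. card (e \<inter> K)) + (\<Sum>e\<in>bd. card (e \<inter> K))"
    using fin_inner fin_bd inner_bd_disjoint by (intro sum.union_disjoint) auto
  also have "(\<Sum>e\<in>inner. card (e \<inter> K)) = (\<Sum>e\<in>inner. 2)"
    using card_edge by (intro sum.cong refl) (simp add: inner_def Int_absorb2)
  also have "(\<Sum>e\<in>bd. card (e \<inter> K)) = (\<Sum>e\<in>bd. 1)" using one by (intro sum.cong refl) simp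
  finally show ?thesis by simp
qed

text \<open>Deleting the boundary port, if there is one, keeps the factor inside \<open>K\<close>.
  By the degree count 2|K| + 2|inner| nodes are left, an even number, and one deleted node keeps the
  rounding bound below 2.\<close>

lemma two_factor:
  assumes r2: "r = 2" and nosep: "\<And>W. W \<subseteq> K \<Longrightarrow> card (cross W) \<noteq> 1" and bd1: "card bd \<le> 1"
  shows "\<exists>F\<subseteq>inner. \<forall>v\<in>K. degree F v = 2"
proof -
  define B where "B = {Port v e | v e. v \<in> K \<and> e \<in> inc v \<and> e \<in> bd}"
  have B: "B \<subseteq> nodes" unfolding B_def by auto
  have cardB: "card B = card bd"
  proof (cases "bd = {}")
    case True
    then have "B = {}" unfolding B_def by auto
    then show ?thesis using True by simp
  next
    case False
    then have "card bd = 1" using bd1 fin_bd by (metis card_0_eq le_neq_implies_less less_one)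
    then obtain e where e: "bd = {e}" by (metis card_1_singletonE)
    then obtain v where v: "e \<inter> K = {v}" using bd_end[of e] by blast
    then have "B = {Port v e}" using e unfolding B_def inc_def bd_def by auto
    then show ?thesis using e by simp
  qed
  have "card (nodes - B) = card nodes - card B"
    using B fin_nodes by (intro card_Diff_subset) (auto intro: finite_subset)
  also have "\<dots> = 2 * card K + 2 * card inner"
    unfolding card_nodes cardB degree_count using r2 by simp
  finally have even: "even (card (nodes - B))" by simp
  have "(\<Sum>a\<in>B. \<Sum>b\<in>B. w a b) \<ge> 0" by (intro sum_nonneg w_nonneg)
  then have "real (card B) - (\<Sum>a\<in>B. \<Sum>b\<in>B. w a b) < 2" using cardB bd1 by simp
  then have "\<exists>M. matching (support_graph nodes w) M \<and> \<Union>M = nodes - B"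
  proof (rule rounding[OF B even])
    fix C assume C: "C \<subseteq> nodes - B" "odd (card C)"
    show "cut_weight nodes w C \<ge> 1"
    proof (rule odd_cut_two[OF r2 nosep])
      fix v e assume "e \<in> bd"
      then show "Port v e \<notin> C" using C(1) unfolding B_def by auto
    qed (use C in auto)
  qed
  then obtain M where M: "matching (support_graph nodes w) M" "\<Union>M = nodes - B" by blast
  define F where "F = {e\<in>E. \<exists>v\<in>K. \<exists>i<r. {Copy v i, Port v e} \<in> M}"
  have "degree F v = r" if "v \<in> K" for v
    unfolding F_def
  proof (rule matching_factor[OF M(1) _ _ that])
    show "Copy v i \<in> \<Union>M" if "v \<in> K" "i < r" for v i using that unfolding M(2) B_def by auto
    show "Port v e \<in> \<Union>M" if "v \<in> K" "e \<in> inc v" "e \<in> inner" for v e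
      using that inner_bd_disjoint[of e] unfolding M(2) B_def by auto
  qed
  moreover have "F \<subseteq> inner"
  proof
    fix f assume "f \<in> F"
    then obtain u i where "u \<in> K" "{Copy u i, Port u f} \<in> M" unfolding F_def by blast
    then have "Port u f \<in> nodes - B" using M(2) by blast
    then show "f \<in> inner" using inc_cases[of u f] unfolding B_def by auto
  qed
  ultimately show ?thesis using r2 by blast
qed

end

section \<open>Spanning subgraphs with cyclic or cubic components\<close>

abbreviation inner_edges :: "'a set set \<Rightarrow> 'a set \<Rightarrow> 'a set set" where
  "inner_edges \<equiv> gadget.inner"

abbreviation boundary_edges :: "'a set set \<Rightarrow> 'a set \<Rightarrow> 'a set set" where
  "boundary_edges \<equiv> gadget.bd"

section \<open>Factors of a single block\<close>

lemma degree_cong: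
  assumes "\<And>e. v \<in> e \<Longrightarrow> e \<in> F \<longleftrightarrow> e \<in> F'"
  shows "degree F v = degree F' v"
proof -
  have "{e\<in>F. v \<in> e} = {e\<in>F'. v \<in> e}" using assms by blast
  then show ?thesis unfolding degree_def by simp
qed

lemma gadgetI:
  assumes "graph V E" "regular V E d" "K \<subseteq> V" "0 < r" "r < d"
  shows "gadget V E d r K"
  using assms unfolding gadget_def regular_def by blast

text \<open>\<open>T\<close> holds the edge to the part already settled, if there is one, and
  \<open>J\<close> tells whether that part uses it. It can always be used; it can be avoided with
  degree \<open>d - 2\<close> if there is another boundary edge, and otherwise by a 2-factor inside
  \<open>K\<close>.\<close>

lemma block_factor:
  assumes G: "graph V E" "regular V E d" and d: "odd d" "5 \<le> d" and K: "K \<subseteq> V"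
    and conn: "\<And>W. W \<subseteq> K \<Longrightarrow> W \<noteq> {} \<Longrightarrow> W \<noteq> K \<Longrightarrow> card (gadget.cross E K W) \<ge> 2"
    and T: "T \<subseteq> boundary_edges E K" "card T \<le> 1" and J: "J \<subseteq> T"
  shows "\<exists>F s. F \<subseteq> inner_edges E K \<union> boundary_edges E K \<and> F \<inter> T = J \<and> (\<forall>v\<in>K. degree F v = s)
    \<and> (s = d - 2 \<or> s = 2 \<and> F \<subseteq> inner_edges E K)"
proof -
  have gr: "gadget V E d (d - 2) K" by (rule gadgetI[OF G K]) (use d in auto)
  have g2: "gadget V E d 2 K" by (rule gadgetI[OF G K]) (use d in auto)
  have odd: "odd d" "odd (d - 2)" "d \<le> 3 * (d - 2)" using d by auto
  have finT: "finite T" using T(1) gadget.fin_bd[OF gr] by (rule finite_subset)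
  show ?thesis
  proof (cases "J = {}")
    case False
    then obtain e where e: "e \<in> J" by blast
    have "T = {e}"
    proof (intro equalityI subsetI)
      fix f assume "f \<in> T"
      then show "f \<in> {e}" using T(2) finT e J card_le_Suc0_iff_eq[OF finT] by auto
    qed (use e J in auto)
    then have JT: "J = {e}" "T = {e}" using e J by auto
    then have "e \<in> boundary_edges E K" using T by auto
    then obtain F where "F \<subseteq> inner_edges E K \<union> boundary_edges E K" "e \<in> F" "\<forall>v\<in>K. degree F v = d - 2"
      using gadget.factor_through[OF gr odd conn] by metis
    then show ?thesis using JT by (intro exI[of _ F] exI[of _ "d - 2"]) auto
  next
    case J0: True
    show ?thesis
    proof (cases "card (boundary_edges E K) \<le> 1")
      case True
      have "card (gadget.cross E K W) \<noteq> 1" if W: "W \<subseteq> K" for W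
      proof (cases "W = {} \<or> W = K")
        case True
        then have "gadget.cross E K W = {}"
          unfolding gadget.cross_def[OF gr] gadget.inner_def[OF gr] by auto
        then show ?thesis by simp
      next
        case False
        then show ?thesis using conn[OF W] by auto
      qed
      then obtain F where F: "F \<subseteq> inner_edges E K" "\<forall>v\<in>K. degree F v = 2"
        using gadget.two_factor[OF g2 refl _ True] by metis
      then have "F \<inter> T = {}" using T gadget.inner_bd_disjoint[OF gr] by blast
      then show ?thesis using F J0 by (intro exI[of _ F] exI[of _ 2]) auto
    next
      case two: False
      show ?thesis
      proof (cases "T = {}")
        case True
        have "boundary_edges E K \<noteq> {}" using two by auto
        then obtain e where "e \<in> boundary_edges E K" by blast
        then obtain F where "F \<subseteq> inner_edges E K \<union> boundary_edges E K" "\<forall>v\<in>K. degree F v = d - 2"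
          using gadget.factor_through[OF gr odd conn] by metis
        then show ?thesis using J0 True by (intro exI[of _ F] exI[of _ "d - 2"]) auto
      next
        case False
        then have "card T = 1" using T(2) finT by (metis card_0_eq le_neq_implies_less less_one)
        then obtain e where e: "T = {e}" by (rule card_1_singletonE)
        then have "e \<in> boundary_edges E K" using T by auto
        moreover have "2 \<le> card (boundary_edges E K)" using two by simp
        ultimately obtain F where "F \<subseteq> inner_edges E K \<union> boundary_edges E K" "e \<notin> F" "\<forall>v\<in>K. degree F v = d - 2"
          using gadget.factor_avoiding[OF gr odd conn] by metis
        then show ?thesis using J0 e by (intro exI[of _ F] exI[of _ "d - 2"]) auto
      qed
    qed
  qed
qed

text \<open>The invariant while blocks are added. Degrees include the edges of \<open>F\<close>
  leaving \<open>X\<close>, which are completed by later blocks; for r \<noteq> 2 the last clause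
  keeps such edges away from 2-regular parts.\<close>

definition edge_regular :: "'a set \<Rightarrow> 'a set set \<Rightarrow> nat \<Rightarrow> bool" where
  "edge_regular X F r \<longleftrightarrow> (\<forall>v\<in>X. degree F v \<in> {2, r})
    \<and> (\<forall>f\<in>F. \<forall>u\<in>f \<inter> X. \<forall>v\<in>f \<inter> X. degree F u = degree F v)
    \<and> (\<forall>f\<in>F. \<not> f \<subseteq> X \<longrightarrow> (\<forall>v\<in>f \<inter> X. degree F v = r))"

text \<open>Edges leaving \<open>X\<close> are left out: they are decided when the block at their
  other end is added.\<close>

definition cut_within :: "'a set set \<Rightarrow> 'a set \<Rightarrow> 'a set \<Rightarrow> 'a set set" where
  "cut_within E X W = {e\<in>E. e \<subseteq> X \<and> e \<inter> W \<noteq> {} \<and> \<not> e \<subseteq> W}"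

text \<open>Minimality of \<open>K\<close> rules out bridges: of the two sides of a cut of \<open>K\<close> with a single edge, one would
  have at most one edge leaving it.\<close>

lemma minimal_block:
  assumes G: "graph V E" and X: "X \<subseteq> V" "X \<noteq> {}"
  obtains K where "K \<subseteq> X" "K \<noteq> {}" "card (cut_within E X K) \<le> 1"
    "\<And>W. W \<subseteq> K \<Longrightarrow> W \<noteq> {} \<Longrightarrow> W \<noteq> K \<Longrightarrow> card (cut_within E K W) \<ge> 2"
proof -
  let ?P = "\<lambda>K. K \<subseteq> X \<and> K \<noteq> {} \<and> card (cut_within E X K) \<le> 1"
  have finX: "finite X" using G X finite_subset unfolding graph_def by auto
  have finE: "finite E" by (rule graph_finite_edges[OF G])
  then have fin: "finite (cut_within E Y W)" for Y W unfolding cut_within_def by simp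
  have "cut_within E X X = {}" unfolding cut_within_def by auto
  then have "?P X" using X by simp
  then obtain K where K: "?P K" and min: "\<And>Y. ?P Y \<Longrightarrow> card K \<le> card Y"
    using ex_has_least_nat[of ?P X card] by blast
  have finK: "finite K" using K finX finite_subset by auto
  have "card (cut_within E K W) \<ge> 2" if W: "W \<subseteq> K" "W \<noteq> {}" "W \<noteq> K" for W
  proof (rule ccontr)
    assume "\<not> ?thesis"
    then have small: "card (cut_within E K W) \<le> 1" by simp
    have leave: "\<exists>e\<in>cut_within E X Y. \<not> e \<subseteq> K" if Y: "Y \<subseteq> K" "Y \<noteq> {}" "Y \<noteq> K" "cut_within E K Y = cut_within E K W" for Y
    proof (rule ccontr)
      assume "\<not> ?thesis"
      then have "cut_within E X Y \<subseteq> cut_within E K Y" unfolding cut_within_def by auto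
      then have "card (cut_within E X Y) \<le> 1" using small Y(4) card_mono[OF fin] le_trans by metis
      then have "card K \<le> card Y" using min[of Y] Y K by auto
      moreover have "card Y < card K" using Y finK by (intro psubset_card_mono) auto
      ultimately show False by simp
    qed
    have "cut_within E K (K - W) = cut_within E K W" using W unfolding cut_within_def by auto
    then obtain e where e: "e \<in> cut_within E X (K - W)" "\<not> e \<subseteq> K" using leave[of "K - W"] W by auto
    obtain f where f: "f \<in> cut_within E X W" "\<not> f \<subseteq> K" using leave[of W] W by auto
    have two: "card e = 2" "card f = 2" using e f G unfolding cut_within_def graph_def by auto
    obtain x y where x: "x \<in> e" "x \<in> K - W" "y \<in> e" "y \<notin> K" using e unfolding cut_within_def by blast
    then have "e = {x, y}" using two(1) card_2_other by (metis Diff_iff insertE singletonD)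
    moreover obtain z where z: "z \<in> f" "z \<in> W" using f unfolding cut_within_def by blast
    ultimately have "e \<noteq> f" using x W by auto
    moreover have "{e, f} \<subseteq> cut_within E X K" using e f x z W unfolding cut_within_def by blast
    then have "card {e, f} \<le> card (cut_within E X K)" by (rule card_mono[OF fin])
    ultimately show False using K by simp
  qed
  then show thesis using that K by blast
qed

text \<open>A block \<open>K\<close> with at most one edge into \<open>X - K\<close> is taken off,
  \<open>X - K\<close> is solved first, and the factor of \<open>K\<close> is then chosen to agree
  with it on that edge. Edges from \<open>K\<close> to the outside of \<open>X\<close> remain
  free.\<close>

lemma edge_regular_extend:
  assumes G: "graph V E" "regular V E d" and d: "odd d" "5 \<le> d" and X: "X \<subseteq> V"
  shows "\<exists>F. F \<subseteq> {e\<in>E. e \<inter> X \<noteq> {}} \<and> edge_regular X F (d - 2)"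
  using X
proof (induction "card X" arbitrary: X rule: less_induct)
  case less
  note X = less.prems
  show ?case
  proof (cases "X = {}")
    case True
    then show ?thesis by (intro exI[of _ "{}"]) (simp add: edge_regular_def)
  next
    case False
    obtain K where K: "K \<subseteq> X" "K \<noteq> {}" "card (cut_within E X K) \<le> 1"
      and conn: "\<And>W. W \<subseteq> K \<Longrightarrow> W \<noteq> {} \<Longrightarrow> W \<noteq> K \<Longrightarrow> card (cut_within E K W) \<ge> 2"
      using minimal_block[OF G(1) X False] by metis
    have finX: "finite X" using G(1) X finite_subset unfolding graph_def by auto
    have KV: "K \<subseteq> V" using K X by auto
    have gr: "gadget V E d 2 K" by (rule gadgetI[OF G KV]) (use d in auto)
    have "card (X - K) < card X" using K finX by (intro psubset_card_mono) auto
    then obtain F' where F': "F' \<subseteq> {e\<in>E. e \<inter> (X - K) \<noteq> {}}" "edge_regular (X - K) F' (d - 2)"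
      using less.hyps[of "X - K"] X by auto
    define T where "T = cut_within E X K"
    have cross: "gadget.cross E K W = cut_within E K W" for W
      unfolding gadget.cross_def[OF gr] gadget.inner_def[OF gr] cut_within_def by auto
    have TB: "T \<subseteq> boundary_edges E K"
      unfolding T_def cut_within_def gadget.bd_def[OF gr] by auto
    \<comment> \<open>The choice \<open>J = F' \<inter> T\<close> transfers the decision made in
      \<open>X - K\<close>.\<close>
    obtain F\<^sub>K s where FK: "F\<^sub>K \<subseteq> inner_edges E K \<union> boundary_edges E K" "F\<^sub>K \<inter> T = F' \<inter> T"
      "\<And>v. v \<in> K \<Longrightarrow> degree F\<^sub>K v = s" "s = d - 2 \<or> s = 2 \<and> F\<^sub>K \<subseteq> inner_edges E K"
      using block_factor[OF G d KV _ TB, of "F' \<inter> T"] conn K(3) unfolding cross T_def by blast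
    have FKE: "f \<in> E" "f \<inter> K \<noteq> {}" if "f \<in> F\<^sub>K" for f
    proof -
      have "f \<in> inner_edges E K \<or> f \<in> boundary_edges E K" using that FK(1) by blast
      then have f: "f \<in> E" "f \<subseteq> K \<or> f \<inter> K \<noteq> {}"
        unfolding gadget.bd_def[OF gr] gadget.inner_def[OF gr] by auto
      then have "f \<noteq> {}" using gadget.card_edge[OF gr] by fastforce
      then show "f \<in> E" "f \<inter> K \<noteq> {}" using f by auto
    qed
    have T_iff: "f \<in> T" if "f \<in> E" "v \<in> f" "v \<in> K" "u \<in> f" "u \<in> X - K" for f u v
    proof -
      have "card f = 2" using that G(1) unfolding graph_def by auto
      then have "f = {v, u}" using that card_2_other by (metis DiffE insertE singletonD)
      then show ?thesis using that K unfolding T_def cut_within_def by auto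
    qed
    define F where "F = F' \<union> F\<^sub>K"
    have degK: "degree F v = s" if v: "v \<in> K" for v
    proof -
      have "degree F v = degree F\<^sub>K v"
      proof (rule degree_cong)
        fix e assume e: "v \<in> e"
        have "e \<in> F\<^sub>K" if eF': "e \<in> F'"
        proof -
          obtain u where "u \<in> e" "u \<in> X - K" "e \<in> E" using subsetD[OF F'(1) eF'] by blast
          then have "e \<in> T" using T_iff e v by blast
          then show ?thesis using that FK(2) by blast
        qed
        then show "e \<in> F \<longleftrightarrow> e \<in> F\<^sub>K" unfolding F_def by blast
      qed
      then show ?thesis using FK(3)[OF v] by simp
    qed
    have in': "e \<in> F'" if e: "e \<in> F\<^sub>K" "v \<in> e" "v \<in> X - K" for e v
    proof -
      obtain u where "u \<in> e" "u \<in> K" using FKE(2)[OF e(1)] by blast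
      then have "e \<in> T" using T_iff FKE(1)[OF e(1)] e by blast
      then show ?thesis using e FK(2) by blast
    qed
    have degX: "degree F v = degree F' v" if v: "v \<in> X - K" for v
      by (rule degree_cong) (use in' v in \<open>auto simp: F_def\<close>)
    have F'r: "degree F' v \<in> {2, d - 2}" if "v \<in> X - K" for v
      using F'(2) that unfolding edge_regular_def by blast
    have F'eq: "degree F' u = degree F' v" if "f \<in> F'" "u \<in> f" "u \<in> X - K" "v \<in> f" "v \<in> X - K" for f u v
      using F'(2) that unfolding edge_regular_def by blast
    have F'out: "degree F' v = d - 2" if "f \<in> F'" "\<not> f \<subseteq> X - K" "v \<in> f" "v \<in> X - K" for f v
      using F'(2) that unfolding edge_regular_def by blast
    have Kin: "f \<in> F\<^sub>K" if f: "f \<in> F" "v \<in> f" "v \<in> K" for f v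
    proof (cases "f \<in> F'")
      case True
      then obtain u where "u \<in> f" "u \<in> X - K" "f \<in> E" using subsetD[OF F'(1) True] by blast
      then have "f \<in> T" using T_iff f by blast
      then show ?thesis using True FK(2) by blast
    qed (use that F_def in auto)
    have out: "s = d - 2" if "f \<in> F\<^sub>K" "\<not> f \<subseteq> K" for f
      using FK(4) that unfolding gadget.inner_def[OF gr] by blast
    have "edge_regular X F (d - 2)"
      unfolding edge_regular_def
    proof (intro conjI ballI impI)
      fix v assume "v \<in> X"
      then show "degree F v \<in> {2, d - 2}" using degK degX F'r FK(4) by (cases "v \<in> K") auto
    next
      \<comment> \<open>The edge between \<open>K\<close> and \<open>X - K\<close> belongs to both
        factors and leaves both sets, which forces degree \<open>d - 2\<close> at each of its
        ends.\<close>
      have mixed: "degree F u = degree F v" if f: "f \<in> F" "u \<in> f" "u \<in> K" "v \<in> f" "v \<in> X - K" for f u v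
      proof -
        have fK: "f \<in> F\<^sub>K" using Kin f by blast
        then have "s = d - 2" using out f by blast
        moreover have "f \<in> F'" using in' fK f by blast
        then have "degree F' v = d - 2" using F'out f by blast
        ultimately show ?thesis using degK degX f by simp
      qed
      fix f u v assume f: "f \<in> F" "u \<in> f \<inter> X" "v \<in> f \<inter> X"
      consider "u \<in> K" "v \<in> K" | "u \<in> K" "v \<notin> K" | "u \<notin> K" "v \<in> K" | "u \<notin> K" "v \<notin> K" by blast
      then show "degree F u = degree F v"
      proof cases
        case 1
        then show ?thesis using degK by simp
      next
        case 2
        then show ?thesis using mixed f by blast
      next
        case 3
        then show ?thesis using mixed[of f v u] f by auto
      next
        case 4
        then have "f \<in> F'" using in' f unfolding F_def by blast
        then show ?thesis using F'eq degX f 4 by auto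
      qed
    next
      fix f v assume f: "f \<in> F" "\<not> f \<subseteq> X" "v \<in> f \<inter> X"
      show "degree F v = d - 2"
      proof (cases "v \<in> K")
        case True
        then have "f \<in> F\<^sub>K" using Kin f by blast
        then show ?thesis using out degK True f K(1) by blast
      next
        case False
        then have "f \<in> F'" using in' f unfolding F_def by blast
        then show ?thesis using F'out[of f v] degX[of v] f False by auto
      qed
    qed
    moreover have "F \<subseteq> {e\<in>E. e \<inter> X \<noteq> {}}"
      using F'(1) FKE K(1) unfolding F_def by blast
    ultimately show ?thesis by blast
  qed
qed

text \<open>With \<open>K = V\<close> there is no boundary, and for even \<open>d\<close> the degree
  count makes every cut even, so no cut consists of one edge.\<close>

lemma petersen_two_factor:
  assumes G: "graph V E" "regular V E d" and d: "even d" "4 \<le> d"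
  shows "\<exists>F\<subseteq>E. \<forall>v\<in>V. degree F v = 2"
proof -
  have gV: "gadget V E d 2 V" by (rule gadgetI[OF G]) (use d in auto)
  have "card (gadget.cross E V W) \<noteq> 1" if W: "W \<subseteq> V" for W
  proof -
    have gW: "gadget V E d 2 W" by (rule gadgetI[OF G W]) (use d in auto)
    have "gadget.cross E V W = boundary_edges E W"
      using G(1) unfolding gadget.cross_def[OF gV] gadget.inner_def[OF gV] gadget.bd_def[OF gW] graph_def
      by auto
    moreover have "even (card (boundary_edges E W))"
      using gadget.degree_count[OF gW] d(1) by (metis dvd_add_right_iff dvd_mult2 dvd_triv_left)
    ultimately show ?thesis by auto
  qed
  moreover have "boundary_edges E V = {}" using G(1) unfolding gadget.bd_def[OF gV] graph_def by auto
  ultimately obtain F where "F \<subseteq> inner_edges E V" "\<forall>v\<in>V. degree F v = 2"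
    using gadget.two_factor[OF gV refl] by (metis card.empty zero_le_one)
  then show ?thesis unfolding gadget.inner_def[OF gV] by blast
qed

text \<open>For odd d \<ge> 5 no edge of \<open>F\<^sub>1\<close> leaves the set of vertices of
  degree \<open>d - 2\<close>. They span a (d - 2)-regular graph, to which induction applies
  separately from the 2-regular remainder.\<close>

theorem regular_component_factor:
  assumes "graph V E" "regular V E d" "2 \<le> d"
  shows "\<exists>F\<subseteq>E. (\<forall>v\<in>V. degree F v \<in> {2, 3}) \<and> (\<forall>f\<in>F. \<forall>u\<in>f. \<forall>v\<in>f. degree F u = degree F v)"
  using assms
proof (induction d arbitrary: V E rule: less_induct)
  case (less d)
  note G = less.prems(1,2)
  have EV: "v \<in> V" if "f \<in> E" "v \<in> f" for f v using G(1) that unfolding graph_def by blast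
  consider "d \<in> {2, 3}" | "even d" "4 \<le> d" | "odd d" "5 \<le> d"
    using less.prems(3) by (cases "d \<in> {2, 3, 4}") auto
  then show ?case
  proof cases
    case 1
    have dd: "degree E v = d" if "v \<in> V" for v using G(2) that unfolding regular_def by blast
    have "degree E u = degree E v" if "f \<in> E" "u \<in> f" "v \<in> f" for f u v
      using dd EV[OF that(1)] that(2,3) by simp
    moreover have "degree E v \<in> {2, 3}" if "v \<in> V" for v using dd[OF that] 1 by simp
    ultimately show ?thesis by blast
  next
    case 2
    then obtain F where F: "F \<subseteq> E" "\<And>v. v \<in> V \<Longrightarrow> degree F v = 2" using petersen_two_factor[OF G] by blast
    have "degree F u = degree F v" if "f \<in> F" "u \<in> f" "v \<in> f" for f u v
      using F(2)[OF EV[of f u]] F(2)[OF EV[of f v]] F(1) that by auto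
    moreover have "degree F v \<in> {2, 3}" if "v \<in> V" for v using F(2)[OF that] by simp
    ultimately show ?thesis using F(1) by blast
  next
    case 3
    obtain F\<^sub>1 where F1: "F\<^sub>1 \<subseteq> E" "edge_regular V F\<^sub>1 (d - 2)"
      using edge_regular_extend[OF G 3 subset_refl] by blast
    have F1V: "v \<in> V" if "f \<in> F\<^sub>1" "v \<in> f" for f v using EV F1(1) that by blast
    have deg1: "degree F\<^sub>1 v = 2 \<or> degree F\<^sub>1 v = d - 2" if "v \<in> V" for v
      using F1(2) that unfolding edge_regular_def by blast
    have eq1: "degree F\<^sub>1 u = degree F\<^sub>1 v" if "f \<in> F\<^sub>1" "u \<in> f" "v \<in> f" for f u v
      using F1(2) that F1V[of f] unfolding edge_regular_def by blast
    define X where "X = {v\<in>V. degree F\<^sub>1 v = d - 2}"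
    define E' where "E' = {f\<in>F\<^sub>1. f \<subseteq> X}"
    have inX: "f \<subseteq> X" if "f \<in> F\<^sub>1" "v \<in> f" "v \<in> X" for f v
      using eq1[OF that(1,2)] F1V[OF that(1)] that(3) unfolding X_def by fastforce
    have GX: "graph X E'"
      using G(1) F1(1) unfolding graph_def E'_def X_def by (auto intro: finite_subset)
    have reg: "regular X E' (d - 2)"
      unfolding regular_def
    proof
      fix v assume v: "v \<in> X"
      have "degree E' v = degree F\<^sub>1 v" by (rule degree_cong) (use inX v in \<open>auto simp: E'_def\<close>)
      then show "degree E' v = d - 2" using v unfolding X_def by simp
    qed
    have "\<exists>F\<subseteq>E'. (\<forall>v\<in>X. degree F v \<in> {2, 3}) \<and> (\<forall>f\<in>F. \<forall>u\<in>f. \<forall>v\<in>f. degree F u = degree F v)"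
      by (rule less.IH[OF _ GX reg]) (use 3 in auto)
    then obtain F\<^sub>2 where F2: "F\<^sub>2 \<subseteq> E'" "\<forall>v\<in>X. degree F\<^sub>2 v \<in> {2, 3}"
      "\<forall>f\<in>F\<^sub>2. \<forall>u\<in>f. \<forall>v\<in>f. degree F\<^sub>2 u = degree F\<^sub>2 v"
      by (elim exE conjE)
    define F where "F = F\<^sub>2 \<union> {f\<in>F\<^sub>1. \<not> f \<subseteq> X}"
    have X2: "f \<subseteq> X" if "f \<in> F\<^sub>2" for f using F2(1) that unfolding E'_def by blast
    have degX: "degree F v = degree F\<^sub>2 v" if "v \<in> X" for v
      by (rule degree_cong) (use inX that in \<open>auto simp: F_def\<close>)
    have degO: "degree F v = 2" if "v \<in> V" "v \<notin> X" for v
    proof -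
      have "degree F v = degree F\<^sub>1 v"
        by (rule degree_cong) (use X2 that in \<open>auto simp: F_def\<close>)
      then show ?thesis using deg1 that unfolding X_def by auto
    qed
    have "degree F u = degree F v" if f: "f \<in> F" "u \<in> f" "v \<in> f" for f u v
    proof (cases "f \<in> F\<^sub>2")
      case True
      then have "u \<in> X" "v \<in> X" using X2[OF True] f by auto
      moreover have "degree F\<^sub>2 u = degree F\<^sub>2 v" by (rule F2(3)[rule_format, OF True f(2,3)])
      ultimately show ?thesis using degX by simp
    next
      case False
      then have f1: "f \<in> F\<^sub>1" "\<not> f \<subseteq> X" using f unfolding F_def by auto
      then have "u \<notin> X" "v \<notin> X" using inX f by blast+
      then show ?thesis using degO F1V f1 f by simp
    qed
    moreover have "degree F v \<in> {2, 3}" if "v \<in> V" for v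
      using degX[of v] degO[of v] bspec[OF F2(2), of v] that by (cases "v \<in> X") simp_all
    moreover have "F \<subseteq> E" using F2(1) F1(1) unfolding F_def E'_def by blast
    ultimately show ?thesis by (intro exI[of _ F] conjI ballI)
  qed
qed

text \<open>Degrees are carried along edges and hence are constant on a component. The walks stay in
  the component, so connectedness holds already for the induced edges, as \<open>is_cycle\<close>
  asks.\<close>

lemma components_cycle_or_cubic:
  assumes F: "graph V F" and deg: "\<And>v. v \<in> V \<Longrightarrow> degree F v \<in> {2, 3}"
    and eq: "\<And>f u v. f \<in> F \<Longrightarrow> u \<in> f \<Longrightarrow> v \<in> f \<Longrightarrow> degree F u = degree F v"
    and C: "C \<in> components V F"
  shows "is_cycle C (induced_edges F C) \<or> is_cubic C (induced_edges F C)"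
proof -
  let ?I = "induced_edges F C"
  obtain x where x: "x \<in> V" "C = {u\<in>V. reach F x u}" using C unfolding components_def by blast
  then have xC: "x \<in> C" by simp
  have edge_in: "e \<subseteq> C" if "e \<in> F" "u \<in> e" "u \<in> C" for e u
  proof
    fix z assume z: "z \<in> e"
    have "card e = 2" "e \<subseteq> V" using F that unfolding graph_def by auto
    then have "z = u \<or> e = {u, z} \<and> z \<in> V" using that(2) z by (auto simp: card_2_iff)
    then show "z \<in> C" using components_edge[OF C that(3), of z] that by auto
  qed
  have degI: "degree ?I v = degree F v" if "v \<in> C" for v
    by (rule degree_cong) (use edge_in that in \<open>auto simp: induced_edges_def\<close>)
  have const: "reach ?I x u \<and> degree F u = degree F x" if "reach F x u" for u
    using that unfolding reach_def[of F]
  proof (induction rule: rtranclp_induct)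
    case (step y z)
    then have yz: "{y, z} \<in> F" by auto
    then have "y \<in> V" using F unfolding graph_def by auto
    then have "y \<in> C" using step.hyps(1) x unfolding reach_def by simp
    then have "{y, z} \<in> ?I" using yz edge_in[OF yz, of y] unfolding induced_edges_def by auto
    then show ?case using step.IH reach_trans reach_edge eq[OF yz, of y z] by (metis insertCI)
  qed simp
  have from_x: "reach F x u" if "u \<in> C" for u using that x(2) by simp
  have reg: "degree ?I u = degree F x" if "u \<in> C" for u
    using degI[OF that] const[OF from_x[OF that]] by simp
  show ?thesis
  proof (cases "degree F x = 2")
    case True
    have "reach ?I u v" if "u \<in> C" "v \<in> C" for u v
      using const[OF from_x[OF that(1)]] const[OF from_x[OF that(2)]] by (meson reach_sym reach_trans)
    moreover have "regular C ?I 2" using reg True unfolding regular_def by simp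
    moreover have "C \<noteq> {}" using xC by auto
    ultimately show ?thesis unfolding is_cycle_def by simp
  next
    case False
    then have "degree F x = 3" using deg[OF x(1)] by simp
    then show ?thesis using reg unfolding is_cubic_def regular_def by simp
  qed
qed

section \<open>Packings of stars and of complete bipartite graphs\<close>

definition verts :: "'a set \<times> 'a set \<Rightarrow> 'a set" where "verts p = fst p \<union> snd p"

definition piece_edges :: "'a set \<times> 'a set \<Rightarrow> 'a set set" where
  "piece_edges p = (\<lambda>(a, l). {a, l}) ` (fst p \<times> snd p)"

text \<open>Complete bipartite graphs with parts of different parity: an edge of \<open>K\<^bsub>r,s\<^esub>\<close> meets
  \<open>r + s - 2\<close> others.\<close>

definition piece :: "'a set \<Rightarrow> 'a set set \<Rightarrow> 'a set \<times> 'a set \<Rightarrow> bool" where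
  "piece V E p \<longleftrightarrow> fst p \<inter> snd p = {} \<and> verts p \<subseteq> V \<and> (\<forall>a\<in>fst p. \<forall>l\<in>snd p. {a, l} \<in> E)
    \<and> (card (fst p) = 1 \<and> even (card (snd p)) \<and> 2 \<le> card (snd p) \<or> card (fst p) = 2 \<and> card (snd p) = 3)"

definition packing :: "'a set \<Rightarrow> 'a set set \<Rightarrow> ('a set \<times> 'a set) set \<Rightarrow> bool" where
  "packing V E P \<longleftrightarrow> (\<forall>p\<in>P. piece V E p) \<and> (\<forall>p\<in>P. \<forall>q\<in>P. p \<noteq> q \<longrightarrow> verts p \<inter> verts q = {})"

text \<open>The number of edges of the piece, which is its contribution to the order of the odd
  induced subgraph.\<close>

definition size_of :: "'a set \<times> 'a set \<Rightarrow> nat" where "size_of p = card (fst p) * card (snd p)"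

section \<open>Packings as odd induced subgraphs of the line graph\<close>

lemma piece_finite:
  assumes "piece V E p" shows "finite (fst p)" "finite (snd p)"
  using assms unfolding piece_def by (auto intro: card_ge_0_finite)

lemma piece_nonempty: "piece V E p \<Longrightarrow> verts p \<noteq> {}"
  unfolding piece_def verts_def by auto

lemma card_verts:
  assumes "piece V E p" shows "card (verts p) = card (fst p) + card (snd p)"
proof -
  have "fst p \<inter> snd p = {}" using assms unfolding piece_def by blast
  then show ?thesis unfolding verts_def using piece_finite[OF assms] by (simp add: card_Un_disjoint)
qed

lemma card_piece_edges:
  assumes "piece V E p" shows "card (piece_edges p) = size_of p"
proof -
  have "inj_on (\<lambda>(a, l). {a, l}) (fst p \<times> snd p)"
    using assms unfolding piece_def by (auto simp: inj_on_def doubleton_eq_iff)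
  then show ?thesis unfolding piece_edges_def size_of_def by (simp add: card_image card_cartesian_product)
qed

lemma packing_subset:
  assumes "packing V E P" shows "P \<subseteq> Pow V \<times> Pow V"
proof
  fix p assume "p \<in> P"
  then have "verts p \<subseteq> V" using assms unfolding packing_def piece_def by blast
  then show "p \<in> Pow V \<times> Pow V" unfolding verts_def by (cases p) simp
qed

lemma packing_finite:
  assumes "finite V" "packing V E P" shows "finite P"
proof (rule finite_subset[OF packing_subset[OF assms(2)]])
  have "finite (Pow V)" using assms(1) by simp
  then show "finite (Pow V \<times> Pow V)" by (rule finite_cartesian_product) fact
qed

lemma finite_packings:
  assumes "finite V" shows "finite {P. packing V E P}"
proof (rule finite_subset)
  show "{P. packing V E P} \<subseteq> Pow (Pow V \<times> Pow V)" using packing_subset by blast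
  have "finite (Pow V)" using assms by simp
  then have "finite (Pow V \<times> Pow V)" by (rule finite_cartesian_product) fact
  then show "finite (Pow (Pow V \<times> Pow V))" by simp
qed

lemma piece_edge_verts: "e \<in> piece_edges p \<Longrightarrow> e \<subseteq> verts p \<and> e \<noteq> {}"
  unfolding piece_edges_def verts_def by auto

text \<open>Different pieces share no vertex, so a selected edge meets selected edges of its own
  piece only. Further edges of \<open>G\<close> inside or between pieces do no harm: they are not
  selected as vertices of the line graph.\<close>

lemma packing_odd_induced:
  assumes P: "packing V E P"
  shows "odd_induced E (line_graph_edges E) (\<Union>p\<in>P. piece_edges p)"
proof -
  let ?S = "\<Union>p\<in>P. piece_edges p"
  have pc: "piece V E p" if "p \<in> P" for p using P that unfolding packing_def by blast
  have SE: "?S \<subseteq> E"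
  proof
    fix e assume "e \<in> ?S"
    then obtain p a l where "p \<in> P" "a \<in> fst p" "l \<in> snd p" "e = {a, l}" unfolding piece_edges_def by auto
    then show "e \<in> E" using pc[of p] unfolding piece_def by simp
  qed
  have "odd (degree (induced_edges (line_graph_edges E) ?S) e)" if eS: "e \<in> ?S" for e
  proof -
    obtain p where p: "p \<in> P" "e \<in> piece_edges p" using eS by blast
    then obtain a l where al: "a \<in> fst p" "l \<in> snd p" "e = {a, l}" unfolding piece_edges_def by auto
    note pp = pc[OF p(1)]
    have disj: "fst p \<inter> snd p = {}" using pp unfolding piece_def by blast
    define N where "N = {f\<in>?S. f \<noteq> e \<and> e \<inter> f \<noteq> {}}"
    have "{x \<in> induced_edges (line_graph_edges E) ?S. e \<in> x} = (\<lambda>f. {e, f}) ` N"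
    proof (intro equalityI subsetI)
      fix x assume "x \<in> {x \<in> induced_edges (line_graph_edges E) ?S. e \<in> x}"
      then have x: "x \<in> line_graph_edges E" "x \<subseteq> ?S" "e \<in> x" unfolding induced_edges_def by simp_all
      from x(1) obtain g h where "x = {g, h}" "g \<noteq> h" "g \<inter> h \<noteq> {}"
        unfolding line_graph_edges_def by blast
      note gh = this x(2,3)
      consider "e = g" | "e = h" using gh by blast
      then show "x \<in> (\<lambda>f. {e, f}) ` N"
      proof cases
        case 1
        then have "h \<in> N" using gh(1-4) unfolding N_def by (simp add: Int_commute)
        then show ?thesis using gh(1) 1 by blast
      next
        case 2
        then have "g \<in> N" using gh(1-4) unfolding N_def by (simp add: Int_commute)
        moreover have "x = {e, g}" using gh(1) 2 by blast
        ultimately show ?thesis by blast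
      qed
    next
      fix x assume "x \<in> (\<lambda>f. {e, f}) ` N"
      then obtain f where f: "x = {e, f}" "f \<in> ?S" "f \<noteq> e" "e \<inter> f \<noteq> {}" unfolding N_def by blast
      moreover have "e \<in> E" "f \<in> E" using SE eS f(2) by blast+
      ultimately have "x \<in> line_graph_edges E" unfolding line_graph_edges_def by blast
      then show "x \<in> {x \<in> induced_edges (line_graph_edges E) ?S. e \<in> x}"
        unfolding induced_edges_def using f(1,2) eS by simp
    qed
    moreover have "inj_on (\<lambda>f. {e, f}) N" unfolding N_def by (auto simp: inj_on_def doubleton_eq_iff)
    ultimately have deg: "degree (induced_edges (line_graph_edges E) ?S) e = card N"
      unfolding degree_def by (simp add: card_image)
    have "N = (\<lambda>l'. {a, l'}) ` (snd p - {l}) \<union> (\<lambda>a'. {a', l}) ` (fst p - {a})"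
    proof (intro equalityI subsetI)
      fix f assume f: "f \<in> N"
      then obtain q where q: "q \<in> P" "f \<in> piece_edges q" unfolding N_def by blast
      have "verts p \<inter> verts q \<noteq> {}"
        using f piece_edge_verts[OF p(2)] piece_edge_verts[OF q(2)] unfolding N_def by blast
      then have "q = p" using P p(1) q(1) unfolding packing_def by blast
      then obtain a' l' where f': "a' \<in> fst p" "l' \<in> snd p" "f = {a', l'}"
        using q(2) unfolding piece_edges_def by auto
      moreover have "a' = a \<or> l' = l" using f f' al disj unfolding N_def by auto
      moreover have "f \<noteq> e" using f unfolding N_def by blast
      ultimately show "f \<in> (\<lambda>l'. {a, l'}) ` (snd p - {l}) \<union> (\<lambda>a'. {a', l}) ` (fst p - {a})"
        using al by auto
    next
      fix f assume "f \<in> (\<lambda>l'. {a, l'}) ` (snd p - {l}) \<union> (\<lambda>a'. {a', l}) ` (fst p - {a})"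
      then obtain a' l' where f: "a' \<in> fst p" "l' \<in> snd p" "f = {a', l'}" "a' = a \<or> l' = l" "a' \<noteq> a \<or> l' \<noteq> l"
        using al by auto
      have "f \<in> piece_edges p" unfolding piece_edges_def using f(1-3) by auto
      moreover have "f \<noteq> e" using f al disj by (auto simp: doubleton_eq_iff)
      moreover have "e \<inter> f \<noteq> {}" using f al by auto
      ultimately show "f \<in> N" unfolding N_def using p(1) by blast
    qed
    moreover have "(\<lambda>l'. {a, l'}) ` (snd p - {l}) \<inter> (\<lambda>a'. {a', l}) ` (fst p - {a}) = {}"
      using disj by (auto simp: doubleton_eq_iff)
    moreover have "inj_on (\<lambda>l'. {a, l'}) (snd p - {l})" "inj_on (\<lambda>a'. {a', l}) (fst p - {a})"
      by (auto simp: inj_on_def doubleton_eq_iff)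
    ultimately have "card N = card (snd p - {l}) + card (fst p - {a})"
      using piece_finite[OF pp] by (simp add: card_Un_disjoint card_image)
    also have "\<dots> = (card (snd p) - 1) + (card (fst p) - 1)" using al by simp
    finally show ?thesis using pp unfolding deg piece_def by auto
  qed
  then show ?thesis using SE unfolding odd_induced_def by blast
qed

lemma packing_card_edges:
  assumes "finite V" "packing V E P"
  shows "card (\<Union>p\<in>P. piece_edges p) = (\<Sum>p\<in>P. size_of p)"
proof -
  have pc: "piece V E p" if "p \<in> P" for p using assms that unfolding packing_def by blast
  have "card (\<Union>p\<in>P. piece_edges p) = (\<Sum>p\<in>P. card (piece_edges p))"
  proof (rule card_UN_disjoint)
    show "finite P" using packing_finite[OF assms] .
    show "\<forall>p\<in>P. finite (piece_edges p)" using piece_finite[OF pc] unfolding piece_edges_def by simp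
    show "\<forall>p\<in>P. \<forall>q\<in>P. p \<noteq> q \<longrightarrow> piece_edges p \<inter> piece_edges q = {}"
    proof (intro ballI impI)
      fix p q assume pq: "p \<in> P" "q \<in> P" "p \<noteq> q"
      then have "verts p \<inter> verts q = {}" using assms(2) unfolding packing_def by blast
      then show "piece_edges p \<inter> piece_edges q = {}" using piece_edge_verts[of _ p] piece_edge_verts[of _ q] by blast
    qed
  qed
  also have "\<dots> = (\<Sum>p\<in>P. size_of p)" using card_piece_edges[OF pc] by (intro sum.cong) auto
  finally show ?thesis .
qed

lemma f_o_ge:
  assumes "finite E" "odd_induced E L S" shows "card S \<le> f_o E L"
  unfolding f_o_def
proof (rule Max_ge)
  have "{card S | S. odd_induced E L S} \<subseteq> card ` Pow E" unfolding odd_induced_def by auto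
  then show "finite {card S | S. odd_induced E L S}" using assms(1) by (meson finite_Pow_iff finite_imageI finite_subset)
qed (use assms(2) in blast)

section \<open>Exchanges and discharging in an optimal packing\<close>

lemma two_elements:
  assumes "2 \<le> card A" obtains a b where "a \<in> A" "b \<in> A" "a \<noteq> b"
proof -
  have "finite A" using assms by (intro card_ge_0_finite) simp
  then show thesis using that assms card_le_Suc0_iff_eq[of A] by fastforce
qed

text \<open>The summand 1 rewards the number of pieces: replacing one piece by two with the same
  total number of edges is already an improvement.\<close>

locale optimal_packing =
  fixes V :: "'a set" and E :: "'a set set" and d :: nat and P :: "('a set \<times> 'a set) set"
  assumes G: "graph V E" and deg: "\<And>v. v \<in> V \<Longrightarrow> degree E v = d" and d: "4 \<le> d"
    and P: "packing V E P"
    and opt: "\<And>Q. packing V E Q \<Longrightarrow> (\<Sum>p\<in>Q. size_of p + 1) \<le> (\<Sum>p\<in>P. size_of p + 1)"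
begin

definition U :: "'a set" where "U = V - (\<Union>p\<in>P. verts p)"

definition nbr :: "'a \<Rightarrow> 'a set" where "nbr v = {u. {v, u} \<in> E}"

text \<open>The share that \<open>u\<close> gives to each covered neighbour; \<open>\<rho> x\<close>
  is what \<open>x\<close> receives in total.\<close>

definition \<phi> :: "'a \<Rightarrow> real" where "\<phi> u = 1 / real (card (nbr u - U))"

definition \<rho> :: "'a \<Rightarrow> real" where "\<rho> x = (\<Sum>u\<in>nbr x \<inter> U. \<phi> u)"

lemma finV: "finite V" using G unfolding graph_def by blast

lemma finU: "finite U" unfolding U_def using finV by simp

lemma UV: "U \<subseteq> V" unfolding U_def by blast

lemma P_piece: "p \<in> P \<Longrightarrow> piece V E p" using P unfolding packing_def by blast

lemma P_disjoint: "p \<in> P \<Longrightarrow> q \<in> P \<Longrightarrow> p \<noteq> q \<Longrightarrow> verts p \<inter> verts q = {}"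
  using P unfolding packing_def by blast

lemma verts_V: "p \<in> P \<Longrightarrow> verts p \<subseteq> V" using P_piece unfolding piece_def by blast

lemma verts_U: "p \<in> P \<Longrightarrow> x \<in> verts p \<Longrightarrow> x \<notin> U" unfolding U_def by blast

lemma finP: "finite P" using packing_finite[OF finV P] .

lemma nbr_sym: "u \<in> nbr v \<longleftrightarrow> v \<in> nbr u" unfolding nbr_def by (simp add: insert_commute)

lemma nbr_neq: "u \<in> nbr v \<Longrightarrow> u \<noteq> v"
  using G unfolding nbr_def graph_def by fastforce

lemma nbr_V: "u \<in> nbr v \<Longrightarrow> u \<in> V"
  using G unfolding nbr_def graph_def by blast

lemma fin_nbr: "finite (nbr v)"
  by (rule finite_subset[OF _ finV]) (use nbr_V in blast)

lemma card_nbr: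
  assumes "v \<in> V" shows "card (nbr v) = d"
proof -
  have "{e\<in>E. v \<in> e} = (\<lambda>u. {v, u}) ` nbr v"
  proof (intro equalityI subsetI)
    fix e assume e: "e \<in> {e\<in>E. v \<in> e}"
    then have "card e = 2" using G unfolding graph_def by blast
    then obtain u where "e = {v, u}" using card_2_other[of e v] e by blast
    then show "e \<in> (\<lambda>u. {v, u}) ` nbr v" using e unfolding nbr_def by blast
  qed (auto simp: nbr_def)
  moreover have "inj_on (\<lambda>u. {v, u}) (nbr v)" by (auto simp: inj_on_def doubleton_eq_iff)
  ultimately have "degree E v = card (nbr v)" unfolding degree_def by (simp add: card_image)
  then show ?thesis using deg[OF assms] by simp
qed

text \<open>The local form of optimality: the pieces in \<open>R\<close> are broken up, and
  \<open>Q\<close> is built from their vertices and uncovered ones, so it stays disjoint from the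
  pieces that are kept.\<close>

lemma exchange:
  assumes R: "R \<subseteq> P" and Q: "packing V E Q" and sub: "\<And>q. q \<in> Q \<Longrightarrow> verts q \<subseteq> (\<Union>p\<in>R. verts p) \<union> U"
  shows "(\<Sum>q\<in>Q. size_of q + 1) \<le> (\<Sum>p\<in>R. size_of p + 1)"
proof -
  have finQ: "finite Q" by (rule packing_finite[OF finV Q])
  have cross: "verts p \<inter> verts q = {}" if p: "p \<in> P - R" and q: "q \<in> Q" for p q
  proof -
    have "verts p \<inter> verts r = {}" if "r \<in> R" for r
    proof (rule P_disjoint)
      show "p \<in> P" "r \<in> P" "p \<noteq> r" using p R that by auto
    qed
    then have "verts p \<inter> (\<Union>r\<in>R. verts r) = {}" by (simp add: Int_UN_distrib)
    moreover have "verts p \<inter> U = {}" using verts_U[of p] p by auto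
    ultimately show ?thesis using sub[OF q] by blast
  qed
  have "(P - R) \<inter> Q = {}"
  proof (rule ccontr)
    assume "\<not> ?thesis"
    then obtain p where p: "p \<in> P - R" "p \<in> Q" by blast
    then have "verts p = {}" using cross[OF p] by simp
    then show False using piece_nonempty[OF P_piece[of p]] p by simp
  qed
  moreover have "packing V E ((P - R) \<union> Q)"
    unfolding packing_def
  proof (intro conjI ballI impI)
    fix p assume "p \<in> (P - R) \<union> Q"
    then show "piece V E p" using P Q unfolding packing_def by blast
  next
    fix p q assume "p \<in> (P - R) \<union> Q" "q \<in> (P - R) \<union> Q" "p \<noteq> q"
    then consider "p \<in> P" "q \<in> P" | "p \<in> P - R" "q \<in> Q" | "p \<in> Q" "q \<in> P - R" | "p \<in> Q" "q \<in> Q" by blast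
    then show "verts p \<inter> verts q = {}"
    proof cases
      case 1
      then show ?thesis using P_disjoint \<open>p \<noteq> q\<close> by simp
    next
      case 2
      then show ?thesis by (rule cross)
    next
      case 3
      then show ?thesis using cross[of q p] by (simp add: Int_commute)
    next
      case 4
      then show ?thesis using Q \<open>p \<noteq> q\<close> unfolding packing_def by blast
    qed
  qed
  ultimately have "(\<Sum>p\<in>P - R. size_of p + 1) + (\<Sum>q\<in>Q. size_of q + 1) \<le> (\<Sum>p\<in>P. size_of p + 1)"
    using opt[of "(P - R) \<union> Q"] finP finQ by (simp add: sum.union_disjoint)
  moreover have "(\<Sum>p\<in>P. size_of p + 1) = (\<Sum>p\<in>P - R. size_of p + 1) + (\<Sum>p\<in>R. size_of p + 1)"
    using R finP by (rule sum.subset_diff)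
  ultimately show ?thesis by linarith
qed

lemma exchange_one:
  assumes "p \<in> P" "piece V E q" "verts q \<subseteq> verts p \<union> U"
  shows "size_of q \<le> size_of p"
proof -
  have "packing V E {q}" using assms(2) unfolding packing_def by simp
  then have "(\<Sum>q\<in>{q}. size_of q + 1) \<le> (\<Sum>p\<in>{p}. size_of p + 1)"
    using assms by (intro exchange) simp_all
  then show ?thesis by simp
qed

lemma exchange_two:
  assumes "p \<in> P" "piece V E q" "piece V E q'" "verts q \<inter> verts q' = {}"
    "verts q \<subseteq> verts p \<union> U" "verts q' \<subseteq> verts p \<union> U"
  shows "size_of q + size_of q' + 1 \<le> size_of p"
proof -
  have "q \<noteq> q'" using assms(4) piece_nonempty[OF assms(2)] by blast
  have "packing V E {q, q'}" using assms(2,3,4) unfolding packing_def by (simp add: Int_commute)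
  then have "(\<Sum>q\<in>{q, q'}. size_of q + 1) \<le> (\<Sum>p\<in>{p}. size_of p + 1)"
    using assms by (intro exchange) auto
  then show ?thesis using \<open>q \<noteq> q'\<close> by simp
qed

lemma no_piece_in_U:
  assumes "piece V E q" shows "\<not> verts q \<subseteq> U"
proof
  assume "verts q \<subseteq> U"
  moreover have "packing V E {q}" using assms unfolding packing_def by simp
  ultimately show False using exchange[of "{}" "{q}"] by simp
qed

lemma star_piece:
  assumes "c \<in> V" "L \<subseteq> nbr c" "even (card L)" "2 \<le> card L"
  shows "piece V E ({c}, L)"
proof -
  have "c \<notin> L" using assms(2) nbr_neq by blast
  moreover have "L \<subseteq> V" using assms(2) nbr_V by blast
  moreover have "\<forall>l\<in>L. {c, l} \<in> E" using assms(2) unfolding nbr_def by blast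
  ultimately show ?thesis using assms unfolding piece_def verts_def by simp
qed

lemma path_piece:
  assumes "x \<in> nbr c" "y \<in> nbr c" "x \<noteq> y"
  shows "piece V E ({c}, {x, y})"
proof (rule star_piece)
  show "c \<in> V" using assms(1) nbr_sym nbr_V by blast
qed (use assms in auto)

text \<open>Two uncovered neighbours of an uncovered vertex would form a new piece K_{1,2}.\<close>

lemma U_nbr_le_1:
  assumes "u \<in> U" shows "card (nbr u \<inter> U) \<le> 1"
proof (rule ccontr)
  assume "\<not> ?thesis"
  then obtain x y where xy: "x \<in> nbr u \<inter> U" "y \<in> nbr u \<inter> U" "x \<noteq> y"
    using card_le_Suc0_iff_eq[of "nbr u \<inter> U"] fin_nbr by auto
  then have "piece V E ({u}, {x, y})" by (intro path_piece) auto
  moreover have "verts ({u}, {x, y}) \<subseteq> U" using xy assms unfolding verts_def by simp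
  ultimately show False using no_piece_in_U by blast
qed

lemma card_outside:
  assumes "u \<in> U" shows "d = card (nbr u - U) + card (nbr u \<inter> U)"
proof -
  have "card (nbr u) = card (nbr u - U) + card (nbr u \<inter> U)"
    using fin_nbr[of u] by (metis card_Diff_subset_Int card_mono finite_Int inf_le1 le_add_diff_inverse2)
  then show ?thesis using card_nbr UV assms by auto
qed

lemma outside_ge: "u \<in> U \<Longrightarrow> d - 1 \<le> card (nbr u - U)"
  using card_outside[of u] U_nbr_le_1[of u] by linarith

lemma phi_le: "u \<in> U \<Longrightarrow> \<phi> u \<le> 1 / (real d - 1)"
  using outside_ge[of u] d unfolding \<phi>_def by (intro divide_left_mono) auto

lemma phi_le_third: "u \<in> U \<Longrightarrow> \<phi> u \<le> 1 / 3"
proof -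
  assume "u \<in> U"
  then have "\<phi> u \<le> 1 / (real d - 1)" by (rule phi_le)
  also have "\<dots> \<le> 1 / 3" using d by (intro divide_left_mono) auto
  finally show ?thesis .
qed

lemma phi_isolated: 
  assumes "u \<in> U" "nbr u \<inter> U = {}" shows "\<phi> u \<le> 1 / 4"
  using card_outside[OF assms(1)] assms(2) d unfolding \<phi>_def by (intro divide_left_mono) auto

lemma rho_le:
  assumes "\<And>u. u \<in> nbr x \<inter> U \<Longrightarrow> \<phi> u \<le> k"
  shows "\<rho> x \<le> real (card (nbr x \<inter> U)) * k"
proof -
  have "\<rho> x \<le> (\<Sum>u\<in>nbr x \<inter> U. k)" unfolding \<rho>_def using assms by (rule sum_mono)
  then show ?thesis by simp
qed

lemma rho_third: "\<rho> x \<le> real (card (nbr x \<inter> U)) / 3"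
  using rho_le[of x "1 / 3"] phi_le_third by auto

text \<open>The neighbour \<open>y\<close> leaves at most \<open>d - 1\<close> uncovered neighbours,
  and each of them shares its charge among at least \<open>d - 1\<close> covered vertices.\<close>

lemma rho_le_1:
  assumes x: "x \<in> V" and y: "y \<in> nbr x" "y \<notin> U" shows "\<rho> x \<le> 1"
proof -
  have "nbr x \<inter> U \<subseteq> nbr x - {y}" using y by blast
  then have "card (nbr x \<inter> U) \<le> card (nbr x - {y})" using fin_nbr by (intro card_mono) auto
  also have "\<dots> = d - 1" using y card_nbr[OF x] fin_nbr by simp
  finally have "real (card (nbr x \<inter> U)) \<le> real d - 1" using d by simp
  then have "real (card (nbr x \<inter> U)) * (1 / (real d - 1)) \<le> (real d - 1) * (1 / (real d - 1))"
    using d by (intro mult_right_mono) auto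
  also have "\<dots> = 1" using d by simp
  finally show ?thesis using rho_le[of x "1 / (real d - 1)"] phi_le by fastforce
qed

lemma rho_empty: "nbr x \<inter> U = {} \<Longrightarrow> \<rho> x = 0" unfolding \<rho>_def by simp

text \<open>Every uncovered vertex distributes the charge \<open>1\<close> equally among its covered neighbours.\<close>

lemma card_U_eq: "real (card U) = (\<Sum>p\<in>P. \<Sum>x\<in>verts p. \<rho> x)"
proof -
  have "(\<Sum>x\<in>nbr u - U. \<phi> u) = 1" if "u \<in> U" for u
    using outside_ge[OF that] d unfolding \<phi>_def by simp
  then have "real (card U) = (\<Sum>u\<in>U. \<Sum>x\<in>nbr u - U. \<phi> u)" by simp
  also have "\<dots> = (\<Sum>u\<in>U. \<Sum>x\<in>{x\<in>V - U. x \<in> nbr u}. \<phi> u)"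
    using nbr_V by (intro sum.cong refl) auto
  also have "\<dots> = (\<Sum>x\<in>V - U. \<Sum>u\<in>{u\<in>U. x \<in> nbr u}. \<phi> u)"
    using finU finV by (intro sum.swap_restrict) auto
  also have "\<dots> = (\<Sum>x\<in>V - U. \<rho> x)"
    unfolding \<rho>_def using nbr_sym by (intro sum.cong refl) auto
  also have "V - U = (\<Union>p\<in>P. verts p)" unfolding U_def using verts_V by blast
  also have "(\<Sum>x\<in>(\<Union>p\<in>P. verts p). \<rho> x) = (\<Sum>p\<in>P. \<Sum>x\<in>verts p. \<rho> x)"
  proof (rule sum.UNION_disjoint[OF finP])
    show "\<forall>p\<in>P. finite (verts p)" using verts_V finV finite_subset by metis
    show "\<forall>p\<in>P. \<forall>q\<in>P. p \<noteq> q \<longrightarrow> verts p \<inter> verts q = {}" using P unfolding packing_def by blast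
  qed
  finally show ?thesis .
qed

lemma covered_nbr:
  assumes p: "p \<in> P" "x \<in> verts p" shows "\<exists>y\<in>nbr x. y \<notin> U"
proof -
  have pc: "piece V E p" by (rule P_piece[OF p(1)])
  have ne: "fst p \<noteq> {}" "snd p \<noteq> {}" using pc unfolding piece_def by auto
  have adj: "\<And>a l. a \<in> fst p \<Longrightarrow> l \<in> snd p \<Longrightarrow> {a, l} \<in> E" using pc unfolding piece_def by simp
  have "\<exists>y\<in>verts p. y \<in> nbr x"
  proof (cases "x \<in> fst p")
    case True
    then show ?thesis using ne adj unfolding verts_def nbr_def by blast
  next
    case False
    then have x: "x \<in> snd p" using p(2) unfolding verts_def by simp
    obtain a where a: "a \<in> fst p" using ne by blast
    have "a \<in> nbr x" using adj[OF a x] unfolding nbr_def by (simp add: insert_commute)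
    then show ?thesis using a unfolding verts_def by blast
  qed
  then show ?thesis using verts_U[OF p(1)] by blast
qed

lemma rho_covered_le_1: "p \<in> P \<Longrightarrow> x \<in> verts p \<Longrightarrow> \<rho> x \<le> 1"
  using covered_nbr[of p x] rho_le_1[of x] verts_V[of p] by blast

lemma star_nbr: "p \<in> P \<Longrightarrow> fst p = {c} \<Longrightarrow> snd p \<subseteq> nbr c \<and> c \<in> V \<and> c \<notin> snd p"
  using P_piece[of p] unfolding piece_def verts_def nbr_def by auto

lemma star_card: "p \<in> P \<Longrightarrow> fst p = {c} \<Longrightarrow> even (card (snd p)) \<and> 2 \<le> card (snd p)"
  using P_piece[of p] unfolding piece_def by auto

text \<open>Two uncovered neighbours could be added as leaves without changing the parity of the
  star.\<close>

lemma center_le_1: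
  assumes p: "p \<in> P" "fst p = {c}" shows "card (nbr c \<inter> U) \<le> 1"
proof (rule ccontr)
  assume "\<not> ?thesis"
  then have "2 \<le> card (nbr c \<inter> U)" by simp
  then obtain u v where uv: "u \<in> nbr c \<inter> U" "v \<in> nbr c \<inter> U" "u \<noteq> v" by (rule two_elements)
  have notin: "u \<notin> snd p" "v \<notin> snd p" using uv verts_U[OF p(1)] unfolding verts_def by auto
  have fin: "finite (snd p)" using piece_finite P_piece p(1) by blast
  define L where "L = snd p \<union> {u, v}"
  have card: "card L = card (snd p) + 2" unfolding L_def using uv notin fin by simp
  have "L \<subseteq> nbr c" using star_nbr[OF p] uv unfolding L_def by simp
  then have "piece V E ({c}, L)"
    using star_nbr[OF p] star_card[OF p] by (intro star_piece) (simp_all add: card)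
  moreover have "verts ({c}, L) \<subseteq> verts p \<union> U" using uv p(2) unfolding verts_def L_def by auto
  ultimately have "size_of ({c}, L) \<le> size_of p" by (rule exchange_one[OF p(1)])
  then show False using card p(2) unfolding size_of_def by simp
qed

text \<open>A leaf with two uncovered neighbours becomes the center of a path of its own. A second
  leaf \<open>l'\<close> is dropped to keep the remaining star even; the number of edges is
  unchanged, and there is one piece more.\<close>

lemma leaf_le_1:
  assumes p: "p \<in> P" "fst p = {c}" "4 \<le> card (snd p)" and l: "l \<in> snd p"
  shows "card (nbr l \<inter> U) \<le> 1"
proof (rule ccontr)
  assume "\<not> ?thesis"
  then have "2 \<le> card (nbr l \<inter> U)" by simp
  then obtain u v where uv: "u \<in> nbr l \<inter> U" "v \<in> nbr l \<inter> U" "u \<noteq> v" by (rule two_elements)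
  have fin: "finite (snd p)" using piece_finite P_piece p(1) by blast
  have "\<exists>l'. l' \<in> snd p - {l}"
  proof (rule ccontr)
    assume "\<not> ?thesis"
    then have "snd p \<subseteq> {l}" by blast
    then have "card (snd p) \<le> 1" using card_mono[of "{l}" "snd p"] by simp
    then show False using p(3) by simp
  qed
  then obtain l' where l': "l' \<in> snd p" "l' \<noteq> l" by blast
  define L where "L = snd p - {l, l'}"
  have card: "card L = card (snd p) - 2"
    unfolding L_def using l l' fin by (simp add: card_Diff_subset)
  have L: "L \<subseteq> snd p" "l \<notin> L" unfolding L_def by auto
  have q1: "piece V E ({l}, {u, v})" using uv by (intro path_piece) auto
  have q2: "piece V E ({c}, L)"
    using star_nbr[OF p(1,2)] star_card[OF p(1,2)] L p(3) card by (intro star_piece) auto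
  have U: "u \<notin> verts p" "v \<notin> verts p" using verts_U[OF p(1)] uv by auto
  have "verts ({l}, {u, v}) \<inter> verts ({c}, L) = {}"
    using U L l star_nbr[OF p(1,2)] p(2) unfolding verts_def by auto
  moreover have "verts ({l}, {u, v}) \<subseteq> verts p \<union> U" using l uv unfolding verts_def by auto
  moreover have "verts ({c}, L) \<subseteq> verts p \<union> U" using L p(2) unfolding verts_def by auto
  ultimately have "size_of ({l}, {u, v}) + size_of ({c}, L) + 1 \<le> size_of p"
    by (rule exchange_two[OF p(1) q1 q2])
  then show False using card p uv(3) unfolding size_of_def by simp
qed

lemma two_paths:
  assumes p: "p \<in> P" "size_of p = 2"
    and "b \<in> nbr a" "b' \<in> nbr a" "b \<noteq> b'" "f \<in> nbr e" "f' \<in> nbr e" "f \<noteq> f'"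
    and "{a, b, b'} \<inter> {e, f, f'} = {}" "{a, b, b'} \<union> {e, f, f'} \<subseteq> verts p \<union> U"
  shows False
proof -
  have "size_of ({a}, {b, b'}) + size_of ({e}, {f, f'}) + 1 \<le> size_of p"
  proof (rule exchange_two[OF p(1)])
    show "piece V E ({a}, {b, b'})" "piece V E ({e}, {f, f'})"
      using assms(3-8) by (auto intro: path_piece)
    show "verts ({a}, {b, b'}) \<inter> verts ({e}, {f, f'}) = {}" using assms(9) unfolding verts_def by simp
    show "verts ({a}, {b, b'}) \<subseteq> verts p \<union> U" "verts ({e}, {f, f'}) \<subseteq> verts p \<union> U"
      using assms(10) unfolding verts_def by simp_all
  qed
  then show False using p(2) assms(5,8) unfolding size_of_def by simp
qed

lemma no_K23:
  assumes p: "p \<in> P" "size_of p = 2" and "a \<noteq> b" "x \<noteq> y" "x \<noteq> z" "y \<noteq> z"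
    and nbrs: "{x, y, z} \<subseteq> nbr a" "{x, y, z} \<subseteq> nbr b" and sub: "{a, b} \<union> {x, y, z} \<subseteq> verts p \<union> U"
  shows False
proof -
  have disj: "a \<notin> {x, y, z}" "b \<notin> {x, y, z}" using nbrs nbr_neq by blast+
  have "verts p \<union> U \<subseteq> V" using verts_V[OF p(1)] UV by simp
  then have "{a, b} \<union> {x, y, z} \<subseteq> V" using sub by (rule subset_trans[rotated])
  then have "verts ({a, b}, {x, y, z}) \<subseteq> V" unfolding verts_def fst_conv snd_conv .
  moreover have "\<forall>g\<in>{a, b}. \<forall>l\<in>{x, y, z}. {g, l} \<in> E" using nbrs unfolding nbr_def by simp
  moreover have "card {a, b} = 2" "card {x, y, z} = 3" using assms(3-6) by simp_all
  ultimately have "piece V E ({a, b}, {x, y, z})" using disj unfolding piece_def by simp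
  moreover have "verts ({a, b}, {x, y, z}) \<subseteq> verts p \<union> U" using sub unfolding verts_def by simp
  ultimately have "size_of ({a, b}, {x, y, z}) \<le> size_of p" by (rule exchange_one[OF p(1)])
  moreover have "size_of ({a, b}, {x, y, z}) = 6"
    using \<open>card {a, b} = 2\<close> \<open>card {x, y, z} = 3\<close> unfolding size_of_def by simp
  ultimately show False using p(2) by simp
qed

text \<open>The path x-c-y can pay only 1. Exchanges into two disjoint paths, a K_{2,3} or a star
  with four leaves restrict its uncovered neighbours so far that bounds of 1/3 or 1/4 per incidence
  suffice.\<close>

lemma path_charge_aux:
  assumes p: "p \<in> P" "fst p = {c}" "snd p = {x, y}" "x \<noteq> y" and X2: "2 \<le> card (nbr x \<inter> U)"
  shows "\<rho> c + (\<rho> x + \<rho> y) \<le> 1"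
proof -
  have size: "size_of p = 2" using p unfolding size_of_def by simp
  have verts: "verts p = {c, x, y}" using p unfolding verts_def by auto
  have nc: "x \<in> nbr c" "y \<in> nbr c" using star_nbr[OF p(1,2)] p(3) by auto
  then have cn: "c \<in> nbr x" "c \<in> nbr y" by (simp_all add: nbr_sym)
  have dist: "x \<noteq> c" "y \<noteq> c" using nc nbr_neq by blast+
  have nU: "c \<notin> U" "x \<notin> U" "y \<notin> U" using verts_U[OF p(1)] verts by auto
  have neU: "z \<noteq> c \<and> z \<noteq> x \<and> z \<noteq> y" if "z \<in> U" for z using that nU by blast
  \<comment> \<open>Otherwise u-x-v and one of y-c-w, c-y-w are two disjoint paths.\<close>
  have other: "w \<notin> nbr c \<and> w \<notin> nbr y"
    if u: "u \<in> nbr x" "u \<in> U" "v \<in> nbr x" "v \<in> U" "u \<noteq> v" and w: "w \<in> U" "w \<noteq> u" "w \<noteq> v" for u v w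
  proof (intro conjI notI)
    assume "w \<in> nbr c"
    then show False
      using two_paths[OF p(1) size u(1,3,5) _ nc(2)] u w p(4) dist neU[of w] neU[of u] neU[of v] verts by auto
  next
    assume "w \<in> nbr y"
    then show False
      using two_paths[OF p(1) size u(1,3,5) _ cn(2)] u w p(4) dist neU[of w] neU[of u] neU[of v] verts by auto
  qed
  show ?thesis
  proof (cases "3 \<le> card (nbr x \<inter> U)")
    case True
    have none: "w \<notin> nbr c \<and> w \<notin> nbr y" if w: "w \<in> U" for w
    proof -
      have "2 \<le> card (nbr x \<inter> U - {w})"
        using True fin_nbr[of x] by (cases "w \<in> nbr x \<inter> U") (simp_all add: card_Diff_singleton)
      then obtain u v where "u \<in> nbr x \<inter> U - {w}" "v \<in> nbr x \<inter> U - {w}" "u \<noteq> v" by (rule two_elements)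
      then show ?thesis using other[of u v w] w by auto
    qed
    then have "\<rho> c = 0" "\<rho> y = 0" using rho_empty by blast+
    moreover have "\<rho> x \<le> 1" using rho_covered_le_1[OF p(1)] verts by simp
    ultimately show ?thesis by simp
  next
    case False
    then have cX: "card (nbr x \<inter> U) = 2" using X2 by simp
    then obtain u v where X: "nbr x \<inter> U = {u, v}" "u \<noteq> v" by (meson card_2_iff)
    then have uv: "u \<in> nbr x" "u \<in> U" "v \<in> nbr x" "v \<in> U" by blast+
    have subs: "nbr c \<inter> U \<subseteq> {u, v}" "nbr y \<inter> U \<subseteq> {u, v}" using other[OF uv X(2)] by blast+
    have c1: "card (nbr c \<inter> U) \<le> 1" by (rule center_le_1[OF p(1,2)])
    \<comment> \<open>Otherwise \<open>x\<close> and \<open>y\<close> have the common neighbours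
      \<open>c\<close>, \<open>u\<close>, \<open>v\<close>.\<close>
    have y1: "card (nbr y \<inter> U) \<le> 1"
    proof (rule ccontr)
      assume "\<not> ?thesis"
      then have "2 \<le> card (nbr y \<inter> U)" by simp
      then obtain s t where "s \<in> nbr y \<inter> U" "t \<in> nbr y \<inter> U" "s \<noteq> t" by (rule two_elements)
      then have "u \<in> nbr y" "v \<in> nbr y" using subs(2) by blast+
      then show False
        using no_K23[OF p(1) size p(4), of c u v] uv X(2) cn neU[of u] neU[of v] verts by auto
    qed
    show ?thesis
    proof (cases "card (nbr c \<inter> U) = 0 \<or> card (nbr y \<inter> U) = 0")
      case True
      then have "real (card (nbr c \<inter> U)) + (real (card (nbr x \<inter> U)) + real (card (nbr y \<inter> U))) \<le> 3"
        using c1 y1 cX by linarith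
      then show ?thesis using rho_third[of c] rho_third[of x] rho_third[of y] by linarith
    next
      case no: False
      then have "card (nbr c \<inter> U) = 1" "card (nbr y \<inter> U) = 1" using c1 y1 by auto
      then obtain s t where st: "nbr c \<inter> U = {s}" "nbr y \<inter> U = {t}" by (meson card_1_singletonE)
      have sc: "s \<in> nbr c" "s \<in> U" and ty: "t \<in> nbr y" "t \<in> U" using st by blast+
      then have cs: "c \<in> nbr s" and yt: "y \<in> nbr t" by (simp_all add: nbr_sym)
      \<comment> \<open>With 2 + 1 + 1 incidences thirds would give 4/3. Shares of at most 1/4
        require that neither \<open>u\<close> nor \<open>v\<close> has an uncovered
        neighbour.\<close>
      have isolated: "nbr a \<inter> U = {}" if ab: "{a, b} = {u, v}" for a b
      proof (rule ccontr)
        assume "nbr a \<inter> U \<noteq> {}"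
        then obtain a' where a': "a' \<in> nbr a" "a' \<in> U" by blast
        have neq: "a \<noteq> b" using ab X(2) by (auto simp: doubleton_eq_iff)
        have abx: "a \<in> nbr x" "a \<in> U" "b \<in> nbr x" "b \<in> U" using ab uv by (auto simp: doubleton_eq_iff)
        then have xa: "x \<in> nbr a" "x \<in> nbr b" by (simp_all add: nbr_sym)
        have s: "s = a \<or> s = b" and t: "t = a \<or> t = b" using subs st ab by (auto simp: doubleton_eq_iff)
        have a'a: "a' \<noteq> a" using a'(1) nbr_neq by blast
        note ne = neU[OF abx(2)] neU[OF abx(4)] neU[OF a'(2)]
        show False
        proof (cases "a' = b")
          case False
          \<comment> \<open>The two disjoint paths are x-a-a' with y-c-b in the first case, x-a-a'
            with c-y-b in the second, and y-a-a' with c-x-b in the third.\<close>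
          consider "s = b" | "t = b" | "s = a" "t = a" using s t by blast
          then show False
          proof cases
            case 1
            then show False
              using two_paths[OF p(1) size xa(1) a'(1) _ nc(2) sc(1)] ne neq a'a False abx a' dist p(4) verts by auto
          next
            case 2
            then show False
              using two_paths[OF p(1) size xa(1) a'(1) _ cn(2) ty(1)] ne neq a'a False abx a' dist p(4) verts by auto
          next
            case 3
            then have "y \<in> nbr a" using yt by simp
            then show False
              using two_paths[OF p(1) size _ a'(1) _ cn(1) abx(3), of y] ne neq a'a False abx a' dist p(4) verts by auto
          qed
        next
          case True
          then have adj: "b \<in> nbr a" "a \<in> nbr b" using a'(1) by (simp_all add: nbr_sym)
          show False
          proof (cases "s = t")
            case True
            \<comment> \<open>Now \<open>s\<close> is adjacent to \<open>x\<close>,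
              \<open>y\<close>, \<open>c\<close> and the other one of \<open>u\<close>,
              \<open>v\<close>, which gives a star with four leaves.\<close>
            define z where "z = (if s = a then b else a)"
            have z: "z \<in> nbr s" "z \<in> U" "z \<noteq> s" using s adj abx neq unfolding z_def by auto
            have "x \<in> nbr s" "y \<in> nbr s" using s xa yt True by auto
            then have sub: "{x, y, c, z} \<subseteq> nbr s" using z cs by simp
            have card: "card {x, y, c, z} = 4" using p(4) dist neU[OF z(2)] by auto
            have "piece V E ({s}, {x, y, c, z})"
              using sub card sc(2) UV by (intro star_piece) auto
            moreover have "verts ({s}, {x, y, c, z}) \<subseteq> verts p \<union> U"
              using verts z(2) sc(2) unfolding verts_def[of "({s}, {x, y, c, z})"] by simp
            ultimately have "size_of ({s}, {x, y, c, z}) \<le> size_of p" by (rule exchange_one[OF p(1)])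
            then show False using card size unfolding size_of_def[of "({s}, {x, y, c, z})"] by simp
          next
            case False
            \<comment> \<open>Now \<open>c\<close> and \<open>t\<close> have the common neighbours
              \<open>x\<close>, \<open>y\<close>, \<open>s\<close>.\<close>
            then have "s \<in> nbr t" "x \<in> nbr t" using s t adj xa by auto
            then show False
              using no_K23[OF p(1) size, of c t x y s] nc sc yt neU[OF sc(2)] neU[OF ty(2)] p(4) sc(2) ty(2) verts
              by auto
          qed
        qed
      qed
      have "nbr u \<inter> U = {}" "nbr v \<inter> U = {}" using isolated[of u v] isolated[of v u] by auto
      then have phi: "\<phi> z \<le> 1 / 4" if "z = u \<or> z = v" for z using phi_isolated that uv by blast
      have quarter: "\<rho> z \<le> real (card (nbr z \<inter> U)) * (1 / 4)" if "nbr z \<inter> U \<subseteq> {u, v}" for z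
        by (rule rho_le) (use phi that in blast)
      show ?thesis
        using quarter[OF subs(1)] quarter[OF subs(2)] quarter[OF equalityD1[OF X(1)]] c1 y1 cX by linarith
    qed
  qed
qed

lemma path_charge:
  assumes p: "p \<in> P" "fst p = {c}" "snd p = {x, y}" "x \<noteq> y"
  shows "\<rho> c + (\<rho> x + \<rho> y) \<le> 1"
proof -
  consider "2 \<le> card (nbr x \<inter> U)" | "2 \<le> card (nbr y \<inter> U)" | "card (nbr x \<inter> U) \<le> 1" "card (nbr y \<inter> U) \<le> 1"
    by linarith
  then show ?thesis
  proof cases
    case 1
    then show ?thesis by (rule path_charge_aux[OF p])
  next
    case 2
    then have "\<rho> c + (\<rho> y + \<rho> x) \<le> 1"
      using p by (intro path_charge_aux[of p]) auto
    then show ?thesis by simp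
  next
    case 3
    then have "real (card (nbr c \<inter> U)) + (real (card (nbr x \<inter> U)) + real (card (nbr y \<inter> U))) \<le> 3"
      using center_le_1[OF p(1,2)] by linarith
    then show ?thesis using rho_third[of c] rho_third[of x] rho_third[of y] by linarith
  qed
qed

text \<open>The right side is the budget left after a piece has paid for its own vertices. For
  K_{2,3}, charges of at most 1 give 5 \<le> 7; for a star with k \<ge> 4 leaves, charges of at most
  1/3 give (k + 1)/3 \<le> k - 1.\<close>

lemma piece_charge:
  assumes p: "p \<in> P"
  shows "(\<Sum>x\<in>verts p. \<rho> x) \<le> 2 * real (size_of p) - real (card (verts p))"
proof -
  have pc: "piece V E p" by (rule P_piece[OF p])
  have fin: "finite (fst p)" "finite (snd p)" using piece_finite[OF pc] by auto
  have cv: "card (verts p) = card (fst p) + card (snd p)" by (rule card_verts[OF pc])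
  consider "card (fst p) = 2" "card (snd p) = 3" | "card (fst p) = 1" "card (snd p) = 2"
    | "card (fst p) = 1" "4 \<le> card (snd p)"
  proof -
    have "card (snd p) \<noteq> 3" if "even (card (snd p))" using that by auto
    then show thesis using that pc unfolding piece_def by (cases "card (snd p) = 2") fastforce+
  qed
  then show ?thesis
  proof cases
    case 1
    have "(\<Sum>x\<in>verts p. \<rho> x) \<le> (\<Sum>x\<in>verts p. 1)" by (rule sum_mono) (rule rho_covered_le_1[OF p])
    then show ?thesis using 1 cv unfolding size_of_def by simp
  next
    case 2
    then obtain c where c: "fst p = {c}" by (meson card_1_singletonE)
    obtain x y where xy: "snd p = {x, y}" "x \<noteq> y" using 2(2) by (meson card_2_iff)
    have "c \<noteq> x" "c \<noteq> y" using star_nbr[OF p c] xy by auto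
    then have "(\<Sum>x\<in>verts p. \<rho> x) = \<rho> c + (\<rho> x + \<rho> y)"
      unfolding verts_def c xy using xy(2) by simp
    then show ?thesis using path_charge[OF p c xy] 2 cv unfolding size_of_def by simp
  next
    case 3
    then obtain c where c: "fst p = {c}" by (meson card_1_singletonE)
    have "\<rho> x \<le> 1 / 3" if "x \<in> verts p" for x
    proof -
      have "card (nbr x \<inter> U) \<le> 1"
        using that center_le_1[OF p c] leaf_le_1[OF p c 3(2)] c unfolding verts_def by auto
      then show ?thesis using rho_third[of x] by linarith
    qed
    then have "(\<Sum>x\<in>verts p. \<rho> x) \<le> (\<Sum>x\<in>verts p. 1 / 3)" by (rule sum_mono)
    then show ?thesis using 3 cv unfolding size_of_def by simp
  qed
qed

lemma packing_covers: "card V \<le> 2 * (\<Sum>p\<in>P. size_of p)"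
proof -
  have "real (card U) \<le> (\<Sum>p\<in>P. 2 * real (size_of p) - real (card (verts p)))"
    unfolding card_U_eq using piece_charge by (rule sum_mono)
  also have "\<dots> = 2 * real (\<Sum>p\<in>P. size_of p) - real (\<Sum>p\<in>P. card (verts p))"
    by (simp add: sum_subtractf sum_distrib_left)
  finally have "card U + (\<Sum>p\<in>P. card (verts p)) \<le> 2 * (\<Sum>p\<in>P. size_of p)" by linarith
  moreover have "V \<subseteq> U \<union> (\<Union>p\<in>P. verts p)" unfolding U_def by blast
  then have "card V \<le> card (U \<union> (\<Union>p\<in>P. verts p))"
  proof (rule card_mono[rotated])
    have "(\<Union>p\<in>P. verts p) \<subseteq> V" using verts_V by blast
    then show "finite (U \<union> (\<Union>p\<in>P. verts p))" using finU finite_subset[OF _ finV] by simp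
  qed
  moreover have "card (U \<union> (\<Union>p\<in>P. verts p)) \<le> card U + card (\<Union>p\<in>P. verts p)" by (rule card_Un_le)
  moreover have "card (\<Union>p\<in>P. verts p) \<le> (\<Sum>p\<in>P. card (verts p))" by (rule card_UN_le[OF finP])
  ultimately show ?thesis by linarith
qed

end

theorem half_order_le_f_o:
  assumes G: "graph V E" "regular V E d" and d: "4 \<le> d"
  shows "card V \<le> 2 * f_o E (line_graph_edges E)"
proof -
  have finV: "finite V" using G unfolding graph_def by blast
  have "packing V E {}" unfolding packing_def by simp
  then have "{P. packing V E P} \<noteq> {}" by blast
  then obtain P where P: "P \<in> {P. packing V E P}"
    and opt: "\<And>Q. Q \<in> {P. packing V E P} \<Longrightarrow> (\<Sum>p\<in>Q. size_of p + 1) \<le> (\<Sum>p\<in>P. size_of p + 1)"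
    using finite_arg_max[OF finite_packings[OF finV], of E "\<lambda>P. \<Sum>p\<in>P. size_of p + 1"] by metis
  have pk: "packing V E P" using P by simp
  have "optimal_packing V E d P"
  proof
    show "graph V E" by (rule G(1))
    show "degree E v = d" if "v \<in> V" for v using G(2) that unfolding regular_def by blast
    show "4 \<le> d" by (rule d)
    show "packing V E P" by (rule pk)
    show "(\<Sum>p\<in>Q. size_of p + 1) \<le> (\<Sum>p\<in>P. size_of p + 1)" if "packing V E Q" for Q
      using opt[of Q] that by simp
  qed
  then have "card V \<le> 2 * (\<Sum>p\<in>P. size_of p)" by (rule optimal_packing.packing_covers)
  also have "\<dots> = 2 * card (\<Union>p\<in>P. piece_edges p)" using packing_card_edges[OF finV pk] by simp
  also have "\<dots> \<le> 2 * f_o E (line_graph_edges E)"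
    using f_o_ge[OF graph_finite_edges[OF G(1)] packing_odd_induced[OF pk]] by simp
  finally show ?thesis .
qed

theorem theorem3p3:
  fixes V :: "'a set" and E :: "'a set set" and d n :: nat
  assumes "graph V E" and "regular V E d" and "card V = n" and "d \<ge> 4"
  shows "\<exists>F. F \<subseteq> E \<and>
     (\<forall>C\<in>components V F. is_cycle C (induced_edges F C) \<or> is_cubic C (induced_edges F C)) \<and>
     real (f_o E (line_graph_edges E)) \<ge> real n / 2 - real (C5_count V F) / 2"
proof -
  have "2 \<le> d" using assms(4) by simp
  then have "\<exists>F\<subseteq>E. (\<forall>v\<in>V. degree F v \<in> {2, 3}) \<and> (\<forall>f\<in>F. \<forall>u\<in>f. \<forall>v\<in>f. degree F u = degree F v)"
    by (rule regular_component_factor[OF assms(1,2)])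
  then obtain F where F: "F \<subseteq> E" "\<forall>v\<in>V. degree F v \<in> {2, 3}"
    "\<forall>f\<in>F. \<forall>u\<in>f. \<forall>v\<in>f. degree F u = degree F v"
    by (elim exE conjE)
  have "graph V F" using assms(1) F(1) unfolding graph_def by blast
  then have "is_cycle C (induced_edges F C) \<or> is_cubic C (induced_edges F C)" if "C \<in> components V F" for C
    using components_cycle_or_cubic[OF _ F(2)[rule_format] F(3)[rule_format] that] by simp
  moreover have "real n / 2 \<le> real (f_o E (line_graph_edges E))"
    using half_order_le_f_o[OF assms(1,2,4)] assms(3) by linarith
  ultimately show ?thesis using F(1) by (intro exI[of _ F]) simp
qed

end
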